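(* Every finitely generated nilpotent group of nilpotency class at most two is a parallel poly-pushdown ($\mathcal P$) group.
   Context: **Languages.** For a finite alphabet $A$, $A^*$ is the free monoid on $A$ (words), $\epsilon$ is the empty word, and a language is a subset of $A^*$. **Deterministic pushdown automata.** A deterministic pushdown automaton is a 7-tuple $M=(S,A,B,\tau,s_0,Z_0,Y)$ with $S$ a finite set of states, $A$ a finite input alphabet, $B$ a finite stack alphabet, $s_0\in S$ the start state, $Z_0\in B$ the start symbol, $Y\subseteq S$ the final states, and $\tau:\Sigma\to S\times B^*$ a map with $\Sigma\subseteq (A\cup\{\epsilon\})\times B\times S$ such that for every $(b,s)\in B\times S$ either $(\epsilon,b,s)\in\Sigma$ and $(a,b,s)\notin\Sigma$ for all $a\in A$, or $(\epsilon,b,s)\notin\Sigma$ and $(a,b,s)\in\Sigma$ for all $a\in A$. An instantaneous description is a triple $(u,z,s)\in A^*\times B^*\times S$ (unread input, stack with top at the right end, state). $M$ makes the transition $(av,yb,s)\to(v,y\alpha,t)$ if $a\in A\cup\{\epsilon\}$, $b\in B$, $(a,b,s)\in \Sigma$ and $\tau(a,b,s)=(t,\alpha)$; $\to^*$ is the reflexive transitive closure. $M$ accepts $w$ by final state if $(w,Z_0,s_0)\to^*(\epsilon,z,s)$ for some $z\in B^*$, $s\in Y$; it accepts $w$ by empty stack if $(w,Z_0,s_0)\to^*(\epsilon,\epsilon,s)$ for some $s\in S$. A language is the language of a deterministic pushdown automaton if it is the set of words accepted by some such $M$ in either one of these two modes. **$\mathcal P$ languages.** $L\subseteq A^*$ is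 parallel poly-pushdown ($\mathcal P$) if it is an intersection of finitely many languages over $A$ of deterministic pushdown automata. **Two-tape version.** Let $\$$ be a symbol not in $A$, and let $(A\cup\{\$\})^\sharp$, $(A\cup\{\$\})^\flat$ be two disjoint copies of $A\cup\{\$\}$, with induced maps on words $u\mapsto u^\sharp$, $v\mapsto v^\flat$. A shuffle $\sigma(u,v)$ of words $u,v$ is a word $u_1^\sharp v_1^\flat\cdots u_k^\sharp v_k^\flat$ with $u=u_1\cdots u_k$, $v=v_1\cdots v_k$, $u_i\ne\epsilon$ for $i>1$, $v_j\neq\epsilon$ for $j<k$. An asynchronous two-tape pushdown automaton over $A$ is a deterministic pushdown automaton $T$ with input alphabet $(A\cup\{\$\})^\sharp\sqcup (A\cup\{\$\})^\flat$ whose states are partitioned into two sets $S_\sharp,S_\flat$. A pair $(u,v)\in A^*\times A^*$ is accepted by $T$ if some shuffle $\sigma(u\$,v\$)$ is accepted by $T$ and, while reading it, $T$ reads letters of $(A\cup\{\$\})^\sharp$ only in states of $S_\sharp$ and letters of $(A\cup\{\$\})^\flat$ only in states of $S_\flat$. The language of $T$ is the set of accepted pairs. A subset of $A^*\times A^*$ is AT$\mathcal P$ (asynchronous two-tape parallel poly-pushdown) if it is the intersection of the languages of finitely many asynchronous two-tape pushdown automata over $A$. **$\mathcal P$ groups.** Let $G$ be a group and $A$ a finite set with a map $A\to G$ such that the induced monoid homomorphism $A^*\to G$, $w\mapsto\overline w$, is surjective. A language $L\subseteq A^*$ is a parallel poly-pushdown structure for $G$ if (1) $w\mapsto \overline w$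 restricts to a bijection $L\to G$; (2) $L$ is $\mathcal P$; (3) for each $a\in A$ the set $\{(w,w')\in L\times L: \overline{w'}=\overline{wa}\}$ is AT$\mathcal P$. $G$ is parallel poly-pushdown (a $\mathcal P$ group) if it has such a structure for some such $A$. *)

theory Defs
  imports "HOL-Algebra.Generated_Groups"
begin

section \<open>Deterministic pushdown automata\<close>

text \<open>The transition function is a partial map whose domain is the set \<open>\<Sigma>\<close>;
  in its first argument, \<open>None\<close> stands for the empty word and \<open>Some a\<close> for a letter.\<close>

record ('a, 'b, 's) dpda =
  states :: "'s set"
  inputs :: "'a set"
  stack_syms :: "'b set"
  delta :: "'a option \<times> 'b \<times> 's \<rightharpoonup> 's \<times> 'b list"
  start :: 's
  start_sym :: 'b
  finals :: "'s set"

definition is_dpda :: "('a, 'b, 's, 'm) dpda_scheme \<Rightarrow> bool" where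
  "is_dpda M \<longleftrightarrow>
     finite (states M) \<and> finite (inputs M) \<and> finite (stack_syms M) \<and>
     start M \<in> states M \<and> start_sym M \<in> stack_syms M \<and> finals M \<subseteq> states M \<and>
     dom (delta M) \<subseteq> ({None} \<union> Some ` inputs M) \<times> stack_syms M \<times> states M \<and>
     ran (delta M) \<subseteq> states M \<times> lists (stack_syms M) \<and>
     (\<forall>b \<in> stack_syms M. \<forall>s \<in> states M.
        (None, b, s) \<in> dom (delta M) \<and> (\<forall>a \<in> inputs M. (Some a, b, s) \<notin> dom (delta M)) \<or>
        (None, b, s) \<notin> dom (delta M) \<and> (\<forall>a \<in> inputs M. (Some a, b, s) \<in> dom (delta M)))"

text \<open>Instantaneous descriptions: unread input, stack (top at the right end), state.\<close>

type_synonym ('a, 'b, 's) description = "'a list \<times> 'b list \<times> 's"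

fun word_of_option :: "'a option \<Rightarrow> 'a list" where
  "word_of_option None = []"
| "word_of_option (Some a) = [a]"

text \<open>The second argument of \<open>dpda_step\<close> records what the transition reads.\<close>

inductive dpda_step ::
    "('a, 'b, 's, 'm) dpda_scheme \<Rightarrow> 'a option
      \<Rightarrow> ('a, 'b, 's) description \<Rightarrow> ('a, 'b, 's) description \<Rightarrow> bool"
  for M :: "('a, 'b, 's, 'm) dpda_scheme" and a :: "'a option" where
  "delta M (a, b, s) = Some (t, \<alpha>) \<Longrightarrow>
     dpda_step M a (word_of_option a @ v, y @ [b], s) (v, y @ \<alpha>, t)"

datatype acceptance_mode = By_Final_State | By_Empty_Stack

fun accepting ::
    "('a, 'b, 's, 'm) dpda_scheme \<Rightarrow> acceptance_mode \<Rightarrow> ('a, 'b, 's) description \<Rightarrow> bool" where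
  "accepting M By_Final_State (u, z, s) \<longleftrightarrow> u = [] \<and> z \<in> lists (stack_syms M) \<and> s \<in> finals M"
| "accepting M By_Empty_Stack (u, z, s) \<longleftrightarrow> u = [] \<and> z = [] \<and> s \<in> states M"

definition accepts ::
    "('a, 'b, 's, 'm) dpda_scheme \<Rightarrow> acceptance_mode \<Rightarrow> 'a list \<Rightarrow> bool" where
  "accepts M m w \<longleftrightarrow>
     (\<exists>c. (\<lambda>c c'. \<exists>a. dpda_step M a c c')\<^sup>*\<^sup>* (w, [start_sym M], start M) c \<and> accepting M m c)"

text \<open>As states and stack symbols form finite sets, it is no restriction to take them
  to be natural numbers.\<close>

definition dpda_language :: "'a set \<Rightarrow> 'a list set \<Rightarrow> bool" where
  "dpda_language A L \<longleftrightarrow>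
     (\<exists>(M :: ('a, nat, nat) dpda) m.
        is_dpda M \<and> inputs M = A \<and> L = {w \<in> lists A. accepts M m w})"

text \<open>The family is required to be nonempty only because \<open>\<Inter>{} = UNIV\<close>; the empty
  intersection \<open>lists A\<close> is itself the language of a deterministic pushdown automaton.\<close>

definition P_language :: "'a set \<Rightarrow> 'a list set \<Rightarrow> bool" where
  "P_language A L \<longleftrightarrow>
     (\<exists>\<L>. finite \<L> \<and> \<L> \<noteq> {} \<and> (\<forall>K \<in> \<L>. dpda_language A K) \<and> L = \<Inter>\<L>)"

section \<open>Asynchronous two-tape automata\<close>

text \<open>\<open>Endmark\<close> is the additional symbol \<open>$\<close>. The two disjoint copies of the extended
  alphabet are the two summands of a sum type: \<open>Inl\<close> is sharp, \<open>Inr\<close> is flat.\<close>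

datatype 'a marked = Letter 'a | Endmark

type_synonym 'a two_tape_letter = "'a marked + 'a marked"

definition marked_alphabet :: "'a set \<Rightarrow> 'a marked set" where
  "marked_alphabet A = insert Endmark (Letter ` A)"

definition end_marked :: "'a list \<Rightarrow> 'a marked list" where
  "end_marked u = map Letter u @ [Endmark]"

definition is_shuffle :: "'c list \<Rightarrow> 'c list \<Rightarrow> ('c + 'c) list \<Rightarrow> bool" where
  "is_shuffle u v w \<longleftrightarrow>
     (\<exists>us vs. length us = length vs \<and> u = concat us \<and> v = concat vs \<and>
        (\<forall>i. 0 < i \<and> i < length us \<longrightarrow> us ! i \<noteq> []) \<and>
        (\<forall>j. Suc j < length vs \<longrightarrow> vs ! j \<noteq> []) \<and>
        w = concat (map2 (\<lambda>x y. map Inl x @ map Inr y) us vs))"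

record ('a, 'b, 's) two_tape = "('a two_tape_letter, 'b, 's) dpda" +
  sharp_states :: "'s set"
  flat_states :: "'s set"

definition is_two_tape :: "'a set \<Rightarrow> ('a, 'b, 's) two_tape \<Rightarrow> bool" where
  "is_two_tape A T \<longleftrightarrow>
     is_dpda T \<and> inputs T = marked_alphabet A <+> marked_alphabet A \<and>
     sharp_states T \<union> flat_states T = states T \<and> sharp_states T \<inter> flat_states T = {}"

fun may_read :: "('a, 'b, 's) two_tape \<Rightarrow> 's \<Rightarrow> 'a two_tape_letter option \<Rightarrow> bool" where
  "may_read T s None \<longleftrightarrow> True"
| "may_read T s (Some (Inl x)) \<longleftrightarrow> s \<in> sharp_states T"
| "may_read T s (Some (Inr x)) \<longleftrightarrow> s \<in> flat_states T"

definition two_tape_step ::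
    "('a, 'b, 's) two_tape \<Rightarrow> ('a two_tape_letter, 'b, 's) description
      \<Rightarrow> ('a two_tape_letter, 'b, 's) description \<Rightarrow> bool" where
  "two_tape_step T c c' \<longleftrightarrow> (\<exists>a. dpda_step T a c c' \<and> may_read T (snd (snd c)) a)"

definition accepts_pair ::
    "('a, 'b, 's) two_tape \<Rightarrow> acceptance_mode \<Rightarrow> 'a list \<times> 'a list \<Rightarrow> bool" where
  "accepts_pair T m = (\<lambda>(u, v).
     \<exists>w c. is_shuffle (end_marked u) (end_marked v) w \<and>
       (two_tape_step T)\<^sup>*\<^sup>* (w, [start_sym T], start T) c \<and> accepting T m c)"

definition two_tape_language :: "'a set \<Rightarrow> ('a list \<times> 'a list) set \<Rightarrow> bool" where
  "two_tape_language A R \<longleftrightarrow>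
     (\<exists>(T :: ('a, nat, nat) two_tape) m.
        is_two_tape A T \<and> R = {p \<in> lists A \<times> lists A. accepts_pair T m p})"

definition ATP_relation :: "'a set \<Rightarrow> ('a list \<times> 'a list) set \<Rightarrow> bool" where
  "ATP_relation A R \<longleftrightarrow>
     (\<exists>\<R>. finite \<R> \<and> \<R> \<noteq> {} \<and> (\<forall>Q \<in> \<R>. two_tape_language A Q) \<and> R = \<Inter>\<R>)"

section \<open>Parallel poly-pushdown groups\<close>

definition word_value :: "('g, 'm) monoid_scheme \<Rightarrow> ('a \<Rightarrow> 'g) \<Rightarrow> 'a list \<Rightarrow> 'g" where
  "word_value G \<phi> w = foldr (\<lambda>x y. x \<otimes>\<^bsub>G\<^esub> y) (map \<phi> w) \<one>\<^bsub>G\<^esub>"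

definition monoid_generators :: "('g, 'm) monoid_scheme \<Rightarrow> 'a set \<Rightarrow> ('a \<Rightarrow> 'g) \<Rightarrow> bool" where
  "monoid_generators G A \<phi> \<longleftrightarrow>
     finite A \<and> \<phi> ` A \<subseteq> carrier G \<and> word_value G \<phi> ` lists A = carrier G"

definition P_structure ::
    "('g, 'm) monoid_scheme \<Rightarrow> 'a set \<Rightarrow> ('a \<Rightarrow> 'g) \<Rightarrow> 'a list set \<Rightarrow> bool" where
  "P_structure G A \<phi> L \<longleftrightarrow>
     L \<subseteq> lists A \<and>
     bij_betw (word_value G \<phi>) L (carrier G) \<and>
     P_language A L \<and>
     (\<forall>a \<in> A. ATP_relation A
        {(w, w'). w \<in> L \<and> w' \<in> L \<and> word_value G \<phi> w' = word_value G \<phi> (w @ [a])})"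

text \<open>As \<open>A\<close> is finite and \<open>\<phi>\<close> need not be injective, it is no restriction to
  take the letters to be natural numbers.\<close>

definition P_group :: "('g, 'm) monoid_scheme \<Rightarrow> bool" where
  "P_group G \<longleftrightarrow>
     group G \<and> (\<exists>(A :: nat set) \<phi> L. monoid_generators G A \<phi> \<and> P_structure G A \<phi> L)"

section \<open>Finitely generated and nilpotent groups\<close>

definition finitely_generated_group :: "('g, 'm) monoid_scheme \<Rightarrow> bool" where
  "finitely_generated_group G \<longleftrightarrow>
     group G \<and> (\<exists>X. finite X \<and> X \<subseteq> carrier G \<and> generate G X = carrier G)"

definition commutator_subgroup ::
    "('g, 'm) monoid_scheme \<Rightarrow> 'g set \<Rightarrow> 'g set \<Rightarrow> 'g set" where
  "commutator_subgroup G H K =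
     generate G (\<Union>h \<in> H. \<Union>k \<in> K. {h \<otimes>\<^bsub>G\<^esub> k \<otimes>\<^bsub>G\<^esub> inv\<^bsub>G\<^esub> h \<otimes>\<^bsub>G\<^esub> inv\<^bsub>G\<^esub> k})"

text \<open>Indexing starts at 0, so \<open>lower_central G c\<close> is the term usually written
  \<open>\<gamma>\<close> with index \<open>c + 1\<close>.\<close>

fun lower_central :: "('g, 'm) monoid_scheme \<Rightarrow> nat \<Rightarrow> 'g set" where
  "lower_central G 0 = carrier G"
| "lower_central G (Suc n) = commutator_subgroup G (lower_central G n) (carrier G)"

definition nilpotent_group :: "('g, 'm) monoid_scheme \<Rightarrow> bool" where
  "nilpotent_group G \<longleftrightarrow> group G \<and> (\<exists>c. lower_central G c = {\<one>\<^bsub>G\<^esub>})"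

definition nilpotency_class :: "('g, 'm) monoid_scheme \<Rightarrow> nat" where
  "nilpotency_class G = (LEAST c. lower_central G c = {\<one>\<^bsub>G\<^esub>})"

end

theory Submission
  imports Defs "HOL-Library.Countable"
begin

text \<open>
  In a group of class at most two the commutators are central, and the commutator map is multiplicative
  in each argument. Hence, when a product of powers of given elements is multiplied by a fixed element and the
  result is collected again in the same order, the exponents change by an \<^emph>\<open>affine\<close> function: noncentral exponents are
  shifted by constants, and the exponents of central elements receive corrections that are linear in
  the old exponents. A counter can check an affine equation, so finitely many counters working
  in parallel can check the multiplication.

  Torsion would spoil this, as exponents would only be determined up to carries. It is avoided by passing to a
  subgroup of finite index. Let \<open>N\<close> be the finitely generated central subgroup generated by commutators. Modulo \<open>N\<close>
  the generators contain a maximal independent family \<open>y\<close>, and \<open>N\<close> has a maximal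
  independent family \<open>z\<close> such that some positive power \<open>M\<close> of every element of \<open>N\<close> is a product of powers
  of \<open>z\<close> (\<open>maximal_independent_subfamily\<close>). The commutators of the elements \<open>y [^] M\<close> are powers with exponent \<open>M\<close> of
  elements of \<open>N\<close>, so the elements \<open>y [^] M\<close> and \<open>z\<close> together generate a subgroup whose members are
  products of powers of these elements, with unique exponents. This subgroup is normal and has finite index, since
  it contains positive powers of the elements of \<open>y\<close> and of \<open>N\<close>, which in turn generate a
  normal subgroup that contains positive powers of all generators (\<open>finitely_many_remainders\<close>). Every
  group element is thus uniquely a coset representative times a product of powers, and the collection
  formulas \<open>swap_power_product\<close> and \<open>power_product_mult_power_product\<close> give the affine action
  (\<open>P_group_of_central_basis\<close>).

  On the side of automata, a normal form is written as a letter for the coset representative followed by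
  blocks of letters for the exponents. These words form a regular language. An affine equation
  between the exponents of two such words is checked by a two-tape automaton that reads the first tape to the
  end and then the second, keeping the difference of both sides of the equation in unary on its stack
  (\<open>two_tape_language_counter\<close>). The coefficients may depend on the coset, which is known from
  the first letter. Intersecting these relations over all coordinates yields the
  multiplication by a generator (\<open>P_group_if_affine_normal_form\<close>).
\<close>

section \<open>Weighted finite automata\<close>

text \<open>As the weights may depend on the state, such a sum can be an affine function of letter counts whose
  coefficients are chosen by the first letter.\<close>

fun run_weight :: "('q \<Rightarrow> 'l \<Rightarrow> 'q) \<Rightarrow> ('q \<Rightarrow> 'l \<Rightarrow> int) \<Rightarrow> 'q \<Rightarrow> 'l list \<Rightarrow> int" where
  "run_weight st wt q [] = 0"
| "run_weight st wt q (x # xs) = wt q x + run_weight st wt (st q x) xs"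

lemma run_weight_append:
  "run_weight st wt q (xs @ ys) = run_weight st wt q xs + run_weight st wt (foldl st q xs) ys"
  by (induction xs arbitrary: q) auto

section \<open>Shuffles that read one tape after the other\<close>

definition sharp_part :: "('a + 'b) list \<Rightarrow> 'a list" where
  "sharp_part w = concat (map (case_sum (\<lambda>x. [x]) (\<lambda>_. [])) w)"

definition flat_part :: "('a + 'b) list \<Rightarrow> 'b list" where
  "flat_part w = concat (map (case_sum (\<lambda>_. []) (\<lambda>y. [y])) w)"

lemma parts_simps [simp]:
  "sharp_part [] = []" "sharp_part (w @ w') = sharp_part w @ sharp_part w'"
  "sharp_part (map Inl x) = x" "sharp_part (map Inr y) = []"
  "flat_part [] = []" "flat_part (w @ w') = flat_part w @ flat_part w'"
  "flat_part (map Inl x) = []" "flat_part (map Inr y) = y"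
  by (simp_all add: sharp_part_def flat_part_def comp_def)

text \<open>A shuffle determines the two words it interleaves. So a shuffle that happens to consist of a sharp
  block followed by a flat block is the one in which the first tape is read to its end before the
  second.\<close>

lemma parts_of_shuffle:
  assumes "is_shuffle u v w"
  shows "sharp_part w = u" and "flat_part w = v"
proof -
  obtain us vs where l: "length us = length vs" and u: "u = concat us" and v: "v = concat vs"
    and w: "w = concat (map2 (\<lambda>x y. map Inl x @ map Inr y) us vs)"
    using assms unfolding is_shuffle_def by blast
  from l show "sharp_part w = u" unfolding u w
    by (induction us vs rule: list_induct2) auto
  from l show "flat_part w = v" unfolding v w
    by (induction us vs rule: list_induct2) auto
qed

lemma shuffle_in_sequence:
  assumes "is_shuffle u v (map Inl x @ map Inr y)"
  shows "u = x" "v = y"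
  using parts_of_shuffle[OF assms] by auto

lemma is_shuffle_sequence: "is_shuffle u v (map Inl u @ map Inr v)"
  unfolding is_shuffle_def by (intro exI[of _ "[u]"] exI[of _ "[v]"]) auto

section \<open>Two-tape pushdown automata with a counter\<close>

datatype phase = Sharp | Flat | Done

instance phase :: countable by countable_datatype

lemma UNIV_phase: "UNIV = {Sharp, Flat, Done}"
  using phase.exhaust by auto

text \<open>Sharp letters are read in phase \<open>Sharp\<close> only, and this phase lasts until the end marker of
  the first tape. A shuffle on which the automaton succeeds is therefore forced to be
  sequential. In phase \<open>Done\<close> the outcome can be tested, as all input has been read.\<close>

fun next_phase :: "phase \<Rightarrow> 'a two_tape_letter \<Rightarrow> phase" where
  "next_phase Sharp (Inl Endmark) = Flat"
| "next_phase Flat (Inr Endmark) = Done"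
| "next_phase p _ = p"

definition unit_sym :: "int \<Rightarrow> nat" where
  "unit_sym k = (if k > 0 then 1 else 2)"

text \<open>An integer is kept in unary above the bottom symbol \<open>0\<close>; its sign is the choice of the unit
  symbol. The counter is \<open>0\<close> iff the bottom symbol is on top.\<close>

definition counter_stack :: "int \<Rightarrow> nat list" where
  "counter_stack n = 0 # replicate (nat \<bar>n\<bar>) (unit_sym n)"

lemma counter_stack_cases:
  obtains (bottom) "n = 0" "counter_stack n = [] @ [0]"
  | (unit) m where "n \<noteq> 0" "m = n - sgn n" "counter_stack n = counter_stack m @ [unit_sym n]"
proof (cases "n = 0")
  case False
  have "counter_stack n = counter_stack (n - sgn n) @ [unit_sym n]"
  proof (cases "n > 0")
    case True
    then have "nat \<bar>n\<bar> = Suc (nat \<bar>n - 1\<bar>)" by auto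
    then show ?thesis using True
      by (cases "n = 1") (auto simp: counter_stack_def unit_sym_def replicate_append_same)
  next
    case neg: False
    then have "nat \<bar>n\<bar> = Suc (nat \<bar>n + 1\<bar>)" using False by auto
    then show ?thesis using neg False
      by (auto simp: counter_stack_def unit_sym_def replicate_append_same)
  qed
  then show thesis using unit False by blast
qed (simp add: bottom counter_stack_def)

text \<open>Adding a unit cancels an opposite unit on top of the stack, or else pushes a unit; the bottom
  symbol is never removed, as it is not a unit symbol.\<close>

lemma counter_stack_move:
  assumes "k \<noteq> 0"
  obtains y b where "counter_stack n = y @ [b]" "b \<in> {0, 1, 2}"
    "counter_stack (n + sgn k) = y @ (if b = unit_sym (- k) then [] else [b, unit_sym k])"
proof -
  consider "n = 0" | "n \<noteq> 0" "sgn n = sgn k" | "n \<noteq> 0" "sgn n = - sgn k"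
    using assms by (cases "n > 0"; cases "k > 0") (force simp: sgn_if)+
  then show thesis
  proof cases
    case 1
    show ?thesis by (rule that[of "[]" 0]) (use assms in \<open>auto simp: 1 counter_stack_def unit_sym_def sgn_if\<close>)
  next
    case 2
    then have n: "unit_sym n = unit_sym k" "unit_sym n \<noteq> unit_sym (- k)"
      "unit_sym (n + sgn k) = unit_sym k"  "n + sgn k \<noteq> 0" "n + sgn k - sgn (n + sgn k) = n"
      by (auto simp: unit_sym_def sgn_if split: if_splits)
    show ?thesis
    proof (rule counter_stack_cases[of n])
      fix m assume m: "counter_stack n = counter_stack m @ [unit_sym n]"
      have "counter_stack (n + sgn k) = counter_stack n @ [unit_sym k]"
        using counter_stack_cases[of "n + sgn k"] n by metis
      then show ?thesis using that[OF m] n m by (auto simp: unit_sym_def split: if_splits)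
    qed (use 2 in simp)
  next
    case 3
    then have n: "unit_sym n = unit_sym (- k)" "n - sgn n = n + sgn k"
      by (auto simp: unit_sym_def sgn_if split: if_splits)
    show ?thesis
    proof (rule counter_stack_cases[of n])
      fix m assume m: "m = n - sgn n" "counter_stack n = counter_stack m @ [unit_sym n]"
      then show ?thesis using that[OF m(2)] n by (auto simp: unit_sym_def split: if_splits)
    qed (use 3 in simp)
  qed
qed

text \<open>The relations recognised here are those that weigh a pair of words, read one after the other, with
  total \<open>0\<close>. Acceptance by states is a special case: rejection is expressed by a weight \<open>1\<close> on an end
  marker, all other weights being \<open>0\<close>.\<close>

locale counter_automaton =
  fixes A :: "'a set" and Q :: "'q::countable set" and q0 :: 'q
    and st :: "'q \<Rightarrow> 'a two_tape_letter \<Rightarrow> 'q" and wt :: "'q \<Rightarrow> 'a two_tape_letter \<Rightarrow> int"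
  assumes finite_A: "finite A" and finite_Q: "finite Q" and q0: "q0 \<in> Q"
    and st: "q \<in> Q \<Longrightarrow> x \<in> marked_alphabet A <+> marked_alphabet A \<Longrightarrow> st q x \<in> Q"
begin

abbreviation "Letters \<equiv> marked_alphabet A <+> marked_alphabet A"

text \<open>A common bound of the absolute values of the weights; it makes the set of pending amounts below
  finite.\<close>

definition bound :: int where
  "bound = (\<Sum>(q, x) \<in> Q \<times> Letters. \<bar>wt q x\<bar>)"

lemma finite_Letters: "finite Letters"
  using finite_A by (simp add: marked_alphabet_def)

lemma bound: "q \<in> Q \<Longrightarrow> x \<in> Letters \<Longrightarrow> \<bar>wt q x\<bar> \<le> bound"
proof -
  assume "q \<in> Q" "x \<in> Letters"
  then have "(\<lambda>(q, x). \<bar>wt q x\<bar>) (q, x) \<le> bound" unfolding bound_def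
    by (intro member_le_sum) (use finite_Q finite_Letters in auto)
  then show ?thesis by simp
qed

lemma bound_nonneg: "0 \<le> bound"
  unfolding bound_def by (auto intro: sum_nonneg)

text \<open>The third component of a state is the amount that has still to be added to the counter. While it
  is nonzero, moves read nothing and shift one unit to the stack; this makes one letter with an
  arbitrary weight compatible with stack moves that see only the top symbol. Once everything is read
  and shifted, the bottom symbol is removed if it is visible, so that the stack becomes empty
  exactly if the total is \<open>0\<close>.\<close>

fun move :: "phase \<times> 'q \<times> int \<Rightarrow> nat \<Rightarrow> 'a two_tape_letter option
    \<Rightarrow> ((phase \<times> 'q \<times> int) \<times> nat list) option" where
  "move (p, q, k) b x =
     (if k \<noteq> 0 then
        if x = None then Some ((p, q, k - sgn k), if b = unit_sym (- k) then [] else [b, unit_sym k])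
        else None
      else if p = Done \<and> b = 0 then if x = None then Some ((p, q, 0), []) else None
      else case x of None \<Rightarrow> None
        | Some l \<Rightarrow> if l \<in> Letters then Some ((next_phase p l, st q l, wt q l), [b]) else None)"

declare move.simps [simp del]

lemma move_settle:
  "k \<noteq> 0 \<Longrightarrow> move (p, q, k) b None =
     Some ((p, q, k - sgn k), if b = unit_sym (- k) then [] else [b, unit_sym k])"
  by (simp add: move.simps)

lemma move_pop: "move (Done, q, 0) 0 None = Some ((Done, q, 0), [])"
  by (simp add: move.simps)

lemma move_read:
  "p \<noteq> Done \<or> b \<noteq> 0 \<Longrightarrow> l \<in> Letters \<Longrightarrow>
     move (p, q, 0) b (Some l) = Some ((next_phase p l, st q l, wt q l), [b])"
  by (auto simp add: move.simps)

lemma move_cases: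
  assumes "move (p, q, k) b x = Some (r, \<alpha>)"
  obtains (settle) "k \<noteq> 0" "x = None" "r = (p, q, k - sgn k)"
      "\<alpha> = (if b = unit_sym (- k) then [] else [b, unit_sym k])"
    | (pop) "k = 0" "x = None" "p = Done" "b = 0" "r = (p, q, 0)" "\<alpha> = []"
    | (read) l where "k = 0" "x = Some l" "l \<in> Letters"
      "r = (next_phase p l, st q l, wt q l)" "\<alpha> = [b]"
proof (cases "k = 0")
  case False
  then show thesis using assms settle unfolding move.simps by (cases x) auto
next
  case k: True
  show thesis
  proof (cases x)
    case None
    then show thesis using assms pop k unfolding move.simps by (simp split: if_splits)
  next
    case (Some l)
    then have "l \<in> Letters" "r = (next_phase p l, st q l, wt q l)" "\<alpha> = [b]"
      using assms k unfolding move.simps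
      by (simp_all only: option.case simp_thms option.distinct split: if_splits) simp_all
    then show thesis by (rule read[OF k Some])
  qed
qed

lemma move_domain: "move r b x = Some c \<Longrightarrow> x \<in> {None} \<union> Some ` Letters"
  by (cases r; cases c) (auto elim: move_cases)

lemma move_deterministic:
  "move r b None \<noteq> None \<and> (\<forall>l \<in> Letters. move r b (Some l) = None) \<or>
   move r b None = None \<and> (\<forall>l \<in> Letters. move r b (Some l) \<noteq> None)"
  by (cases r) (auto simp: move.simps)

abbreviation enc :: "phase \<Rightarrow> 'q \<Rightarrow> int \<Rightarrow> nat" where
  "enc p q k \<equiv> to_nat (p, q, k)"

definition pda_states :: "phase set \<Rightarrow> (phase \<times> 'q \<times> int) set" where
  "pda_states P = P \<times> Q \<times> {- bound..bound}"

definition pda :: "('a, nat, nat) two_tape" where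
  "pda = \<lparr>states = to_nat ` pda_states UNIV, inputs = Letters, stack_syms = {0, 1, 2},
     delta = (\<lambda>(x, b, s). if s \<in> to_nat ` pda_states UNIV \<and> b \<in> {0, 1, 2}
        then map_option (\<lambda>(r, \<alpha>). (to_nat r, \<alpha>)) (move (from_nat s) b x) else None),
     start = to_nat (Sharp, q0, 0 :: int), start_sym = 0, finals = {},
     sharp_states = to_nat ` pda_states {Sharp},
     flat_states = to_nat ` pda_states {Flat, Done}\<rparr>"

lemma move_range:
  assumes "r \<in> pda_states UNIV" "b \<in> {0, 1, 2}" "move r b x = Some (r', \<alpha>)"
  shows "r' \<in> pda_states UNIV" "\<alpha> \<in> lists {0, 1, 2}"
proof -
  obtain p q k where r: "r = (p, q, k)" by (cases r)
  have k: "q \<in> Q" "- bound \<le> k" "k \<le> bound" using assms(1) by (auto simp: r pda_states_def)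
  from assms(3)[unfolded r] have "r' \<in> pda_states UNIV \<and> \<alpha> \<in> lists {0, 1, 2}"
  proof (cases rule: move_cases)
    case settle
    then show ?thesis using k assms(2)
      by (auto simp: pda_states_def unit_sym_def sgn_if split: if_splits)
  next
    case pop
    then show ?thesis using k bound_nonneg by (auto simp: pda_states_def)
  next
    case (read l)
    then show ?thesis using k st[of q l] bound[of q l] assms(2) by (simp add: pda_states_def abs_le_iff)
  qed
  then show "r' \<in> pda_states UNIV" "\<alpha> \<in> lists {0, 1, 2}" by auto
qed

lemma is_two_tape_pda: "is_two_tape A pda"
proof -
  have fin: "finite (pda_states UNIV)"
    by (auto simp: pda_states_def finite_Q UNIV_phase)
  have start: "(Sharp, q0, 0) \<in> pda_states UNIV"
    using q0 bound_nonneg by (auto simp: pda_states_def)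
  have dom: "dom (delta pda) \<subseteq> ({None} \<union> Some ` Letters) \<times> {0, 1, 2} \<times> to_nat ` pda_states UNIV"
  proof
    fix c assume c: "c \<in> dom (delta pda)"
    obtain x b s where cc: "c = (x, b, s)" by (cases c)
    have s: "s \<in> to_nat ` pda_states UNIV" "b \<in> {0, 1, 2}" and m: "move (from_nat s) b x \<noteq> None"
      using c unfolding cc by (auto simp: pda_def split: if_splits)
    have "x \<in> {None} \<union> Some ` Letters" using m move_domain by blast
    then show "c \<in> ({None} \<union> Some ` Letters) \<times> {0, 1, 2} \<times> to_nat ` pda_states UNIV"
      using s unfolding cc by (simp only: mem_Sigma_iff simp_thms)
  qed
  have ran: "ran (delta pda) \<subseteq> to_nat ` pda_states UNIV \<times> lists {0, 1, 2}"
  proof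
    fix y assume "y \<in> ran (delta pda)"
    then obtain x b s where "delta pda (x, b, s) = Some y" unfolding ran_def by auto
    then obtain r r' \<alpha> where "r \<in> pda_states UNIV" "b \<in> {0, 1, 2}" "move r b x = Some (r', \<alpha>)"
      and y: "y = (to_nat r', \<alpha>)"
      by (auto simp: pda_def split: if_splits)
    from move_range[OF this(1-3)] show "y \<in> to_nat ` pda_states UNIV \<times> lists {0, 1, 2}"
      unfolding y by blast
  qed
  have det: "(None, b, s) \<in> dom (delta pda) \<and> (\<forall>a \<in> Letters. (Some a, b, s) \<notin> dom (delta pda)) \<or>
        (None, b, s) \<notin> dom (delta pda) \<and> (\<forall>a \<in> Letters. (Some a, b, s) \<in> dom (delta pda))"
    if "b \<in> {0, 1, 2}" "s \<in> to_nat ` pda_states UNIV" for b s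
  proof -
    have "(y, b, s) \<in> dom (delta pda) \<longleftrightarrow> move (from_nat s) b y \<noteq> None" for y
      using that by (simp add: pda_def domIff del: not_None_eq)
    then show ?thesis using move_deterministic[of "from_nat s" b] by (simp only: simp_thms)
  qed
  have "to_nat ` pda_states {Sharp} \<union> to_nat ` pda_states {Flat, Done} = to_nat ` pda_states UNIV"
    unfolding pda_states_def UNIV_phase by blast
  moreover have "to_nat ` pda_states {Sharp} \<inter> to_nat ` pda_states {Flat, Done} = {}"
    by (auto simp: pda_states_def)
  ultimately show ?thesis
    unfolding is_two_tape_def is_dpda_def
    using fin start dom ran det finite_Letters by (simp add: pda_def)
qed

lemma pda_step:
  assumes "r \<in> pda_states UNIV" "b \<in> {0, 1, 2}" "move r b x = Some (r', \<alpha>)"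
    "\<And>y. x = Some (Inl y) \<Longrightarrow> fst r = Sharp" "\<And>y. x = Some (Inr y) \<Longrightarrow> fst r \<noteq> Sharp"
  shows "two_tape_step pda (word_of_option x @ v, y @ [b], to_nat r) (v, y @ \<alpha>, to_nat r')"
proof -
  have "delta pda (x, b, to_nat r) = Some (to_nat r', \<alpha>)"
    using assms(1-3) by (simp add: pda_def)
  then have "dpda_step pda x (word_of_option x @ v, y @ [b], to_nat r) (v, y @ \<alpha>, to_nat r')"
    by (rule dpda_step.intros)
  moreover have "may_read pda (to_nat r) x"
  proof (cases x)
    case (Some l)
    then show ?thesis using assms(1,4,5) UNIV_phase
      by (cases l) (auto simp: pda_def pda_states_def)
  qed simp
  ultimately show ?thesis unfolding two_tape_step_def by auto
qed

lemma settle: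
  assumes "q \<in> Q" "\<bar>k\<bar> \<le> bound"
  shows "(two_tape_step pda)\<^sup>*\<^sup>* (v, counter_stack n, enc p q k)
     (v, counter_stack (n + k), enc p q 0)"
  using assms(2)
proof (induction "nat \<bar>k\<bar>" arbitrary: k n)
  case 0
  then show ?case by simp
next
  case (Suc m)
  then have k: "k \<noteq> 0" by auto
  obtain y b where y: "counter_stack n = y @ [b]" "b \<in> {0, 1, 2}"
    "counter_stack (n + sgn k) = y @ (if b = unit_sym (- k) then [] else [b, unit_sym k])"
    using counter_stack_move[OF k] by metis
  have "two_tape_step pda (word_of_option None @ v, y @ [b], enc p q k)
     (v, y @ (if b = unit_sym (- k) then [] else [b, unit_sym k]), enc p q (k - sgn k))"
    using assms(1) Suc.prems k y(2) move_settle by (intro pda_step) (auto simp: pda_states_def)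
  then have "two_tape_step pda (v, counter_stack n, enc p q k)
     (v, counter_stack (n + sgn k), enc p q (k - sgn k))"
    using y by simp
  also have "(two_tape_step pda)\<^sup>*\<^sup>* (v, counter_stack (n + sgn k), enc p q (k - sgn k))
     (v, counter_stack (n + sgn k + (k - sgn k)), enc p q 0)"
    by (rule Suc.hyps(1)) (use Suc.hyps(2) Suc.prems in \<open>auto simp: sgn_if split: if_splits\<close>)
  finally show ?case by simp
qed

lemma read_letter:
  assumes "q \<in> Q" "x \<in> Letters" "p \<noteq> Done" "isl x \<longleftrightarrow> p = Sharp"
  shows "(two_tape_step pda)\<^sup>*\<^sup>* (x # v, counter_stack n, enc p q 0)
     (v, counter_stack (n + wt q x), enc (next_phase p x) (st q x) 0)"
proof -
  obtain y b where y: "counter_stack n = y @ [b]" "b \<in> {0, 1, 2}"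
    by (rule counter_stack_move[of 1]) auto
  have "two_tape_step pda (word_of_option (Some x) @ v, y @ [b], enc p q 0)
     (v, y @ [b], enc (next_phase p x) (st q x) (wt q x))"
    using assms y(2) bound_nonneg move_read by (intro pda_step) (auto simp: pda_states_def)
  then have "two_tape_step pda (x # v, counter_stack n, enc p q 0)
     (v, counter_stack n, enc (next_phase p x) (st q x) (wt q x))"
    using y by simp
  also have "(two_tape_step pda)\<^sup>*\<^sup>* \<dots>
     (v, counter_stack (n + wt q x), enc (next_phase p x) (st q x) 0)"
    using st bound assms by (intro settle) auto
  finally show ?thesis .
qed

lemma read_letters:
  assumes "q \<in> Q" "set xs \<subseteq> Letters" "p \<noteq> Done" "\<And>x. x \<in> set xs \<Longrightarrow> isl x \<longleftrightarrow> p = Sharp"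
    "\<And>x. x \<in> set xs \<Longrightarrow> next_phase p x = p"
  shows "foldl st q xs \<in> Q \<and> (two_tape_step pda)\<^sup>*\<^sup>* (xs @ v, counter_stack n, enc p q 0)
     (v, counter_stack (n + run_weight st wt q xs), enc p (foldl st q xs) 0)"
  using assms
proof (induction xs arbitrary: q n)
  case (Cons x xs)
  have x: "x \<in> Letters" "isl x \<longleftrightarrow> p = Sharp" "next_phase p x = p"
    using Cons.prems(2) Cons.prems(4,5)[of x] by auto
  have "(two_tape_step pda)\<^sup>*\<^sup>* (x # xs @ v, counter_stack n, enc p q 0)
     (xs @ v, counter_stack (n + wt q x), enc p (st q x) 0)"
    using read_letter[OF Cons.prems(1) x(1) Cons.prems(3) x(2), of "xs @ v" n] x(3) by simp
  moreover have "foldl st (st q x) xs \<in> Q \<and> (two_tape_step pda)\<^sup>*\<^sup>*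
     (xs @ v, counter_stack (n + wt q x), enc p (st q x) 0)
     (v, counter_stack (n + wt q x + run_weight st wt (st q x) xs),
       enc p (foldl st (st q x) xs) 0)"
    using Cons.prems st x by (intro Cons.IH) auto
  ultimately show ?case by (auto simp: algebra_simps)
qed simp

abbreviation "total_weight u v \<equiv> run_weight st wt q0 (map Inl (end_marked u) @ map Inr (end_marked v))"

lemma accepts_if:
  assumes "u \<in> lists A" "v \<in> lists A" "total_weight u v = 0"
  shows "accepts_pair pda By_Empty_Stack (u, v)"
proof -
  define xs ys :: "'a two_tape_letter list" where "xs = map Inl (map Letter u)" and "ys = map Inr (map Letter v)"
  define q1 where "q1 = foldl st q0 xs"
  define q2 where "q2 = st q1 (Inl Endmark)"
  define q3 where "q3 = foldl st q2 ys"
  define q4 where "q4 = st q3 (Inr Endmark)"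
  define n1 n2 n3 n4 where "n1 = run_weight st wt q0 xs" and "n2 = n1 + wt q1 (Inl Endmark)"
    and "n3 = n2 + run_weight st wt q2 ys" and "n4 = n3 + wt q3 (Inr Endmark)"
  note defs = q1_def q2_def q3_def q4_def n1_def n2_def n3_def n4_def
  have w: "map Inl (end_marked u) @ map Inr (end_marked v) = xs @ Inl Endmark # ys @ [Inr Endmark]"
    by (simp add: end_marked_def xs_def ys_def)
  have n4: "n4 = 0"
    using assms(3) unfolding w by (simp add: run_weight_append defs)
  have l: "set xs \<subseteq> Letters" "set ys \<subseteq> Letters" "Inl Endmark \<in> Letters" "Inr Endmark \<in> Letters"
    using assms by (auto simp: xs_def ys_def marked_alphabet_def)
  have phases: "\<And>x. x \<in> set xs \<Longrightarrow> isl x \<and> next_phase Sharp x = Sharp"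
    "\<And>x. x \<in> set ys \<Longrightarrow> \<not> isl x \<and> next_phase Flat x = Flat"
    by (auto simp: xs_def ys_def)
  have s1: "q1 \<in> Q" "(two_tape_step pda)\<^sup>*\<^sup>*
     (xs @ Inl Endmark # ys @ [Inr Endmark], counter_stack 0, enc Sharp q0 0)
     (Inl Endmark # ys @ [Inr Endmark], counter_stack n1, enc Sharp q1 0)"
    using read_letters[OF q0 l(1), of Sharp "Inl Endmark # ys @ [Inr Endmark]" 0] phases
    by (simp_all add: q1_def n1_def)
  have s2: "(two_tape_step pda)\<^sup>*\<^sup>*
     (Inl Endmark # ys @ [Inr Endmark], counter_stack n1, enc Sharp q1 0)
     (ys @ [Inr Endmark], counter_stack n2, enc Flat q2 0)"
    using read_letter[OF s1(1) l(3), of Sharp] unfolding n2_def q2_def by simp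
  have q2: "q2 \<in> Q" using s1 l st by (simp add: q2_def)
  have s3: "q3 \<in> Q" "(two_tape_step pda)\<^sup>*\<^sup>*
     (ys @ [Inr Endmark], counter_stack n2, enc Flat q2 0)
     ([Inr Endmark], counter_stack n3, enc Flat q3 0)"
    using read_letters[OF q2 l(2), of Flat "[Inr Endmark]" n2] phases
    by (simp_all add: n3_def q3_def)
  have s4: "(two_tape_step pda)\<^sup>*\<^sup>*
     ([Inr Endmark], counter_stack n3, enc Flat q3 0)
     ([], counter_stack n4, enc Done q4 0)"
    using read_letter[OF s3(1) l(4), of Flat] unfolding n4_def q4_def by simp
  have q4: "(Done, q4, 0) \<in> pda_states UNIV"
    using s3 l st bound_nonneg by (simp add: q4_def pda_states_def)
  then have s5: "two_tape_step pda ([], counter_stack n4, enc Done q4 0)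
     ([], [], enc Done q4 0)"
    using pda_step[OF q4 _ move_pop, of "[]" "[]"] n4
    by (simp add: counter_stack_def)
  have "(two_tape_step pda)\<^sup>*\<^sup>* (map Inl (end_marked u) @ map Inr (end_marked v),
      [start_sym pda], start pda) ([], [], enc Done q4 0)"
    using s1 s2 s3 s4 s5 unfolding w
    by (simp add: pda_def counter_stack_def)
  moreover have "accepting pda By_Empty_Stack ([], [], enc Done q4 0)"
    using q4 by (simp add: pda_def)
  ultimately show ?thesis unfolding accepts_pair_def using is_shuffle_sequence by blast
qed

text \<open>The quantity that every move preserves is the counter plus the pending amount plus the weight of
  the unread input. The alternative of an empty stack covers the time after the bottom symbol has been
  removed. The last line records that the input read so far is a sharp block followed by a flat block.\<close>

definition pda_invariant ::
    "'a two_tape_letter list \<Rightarrow> ('a two_tape_letter, nat, nat) description \<Rightarrow> bool" where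
  "pda_invariant w c \<longleftrightarrow> (\<exists>v z p q k n x y.
     c = (v, z, enc p q k) \<and> (z = counter_stack n \<or> z = [] \<and> n = 0 \<and> k = 0) \<and>
     run_weight st wt q0 w = n + k + run_weight st wt q v \<and>
     w = map Inl x @ map Inr y @ v \<and> (p = Sharp \<longrightarrow> y = []))"

lemma pda_invariant_step:
  assumes inv: "pda_invariant w c" and step: "two_tape_step pda c c'"
  shows "pda_invariant w c'"
proof -
  obtain a where s: "dpda_step pda a c c'" and may: "may_read pda (snd (snd c)) a"
    using step two_tape_step_def by blast
  obtain v z p q k n x y where c: "c = (v, z, enc p q k)"
    and z: "z = counter_stack n \<or> z = [] \<and> n = 0 \<and> k = 0"
    and r: "run_weight st wt q0 w = n + k + run_weight st wt q v"
    and w: "w = map Inl x @ map Inr y @ v" and ph: "p = Sharp \<longrightarrow> y = []"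
    using inv unfolding pda_invariant_def by blast
  from s obtain b t \<alpha> v' z' where d: "delta pda (a, b, enc p q k) = Some (t, \<alpha>)"
    and v: "v = word_of_option a @ v'" and zz: "z = z' @ [b]" and c': "c' = (v', z' @ \<alpha>, t)"
    unfolding c by (auto elim: dpda_step.cases)
  have z: "counter_stack n = z' @ [b]" using z zz by auto
  obtain r' where m: "move (p, q, k) b a = Some (r', \<alpha>)" and t: "t = to_nat r'"
    using d by (auto simp: pda_def split: if_splits)
  from m show ?thesis
  proof (cases rule: move_cases)
    case settle
    have "counter_stack (n + sgn k) = z' @ \<alpha>"
      using counter_stack_move[OF settle(1), of n] z unfolding settle by (metis append1_eq_conv)
    then have "c' = (v, counter_stack (n + sgn k), enc p q (k - sgn k))"
      using v by (simp add: c' t settle)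
    then show ?thesis unfolding pda_invariant_def using r w ph
      by (intro exI[of _ v] exI[of _ "counter_stack (n + sgn k)"] exI[of _ p] exI[of _ q]
        exI[of _ "k - sgn k"] exI[of _ "n + sgn k"] exI[of _ x] exI[of _ y]) auto
  next
    case pop
    have "n = 0 \<and> z' = []"
    proof (rule counter_stack_cases[of n])
      fix m assume "counter_stack n = counter_stack m @ [unit_sym n]"
      then show ?thesis using z pop by (auto simp: unit_sym_def split: if_splits)
    qed (use z in auto)
    then have "c' = (v, [], enc p q k)" "n = 0"
      using v pop by (auto simp: c' t)
    then show ?thesis unfolding pda_invariant_def using r w ph pop
      by (intro exI[of _ v] exI[of _ "[]"] exI[of _ p] exI[of _ q]
        exI[of _ k] exI[of _ 0] exI[of _ x] exI[of _ y]) auto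
  next
    case (read l)
    have c': "c' = (v', counter_stack n, enc (next_phase p l) (st q l) (wt q l))"
      using z by (simp add: c' t read)
    have v: "v = l # v'" using v read by simp
    have "\<exists>x' y'. w = map Inl x' @ map Inr y' @ v' \<and> (next_phase p l = Sharp \<longrightarrow> y' = [])"
    proof (cases l)
      case (Inl e)
      then have "p = Sharp" using may read by (auto simp: pda_def pda_states_def c)
      then show ?thesis using w ph v Inl by (intro exI[of _ "x @ [e]"] exI[of _ "[]"]) auto
    next
      case (Inr e)
      then have "p \<noteq> Sharp" using may read by (auto simp: pda_def pda_states_def c)
      then have "next_phase p l \<noteq> Sharp" by (cases "(p, l)" rule: next_phase.cases) auto
      then show ?thesis using w v Inr by (intro exI[of _ x] exI[of _ "y @ [e]"]) auto
    qed
    then obtain x' y' where xy: "w = map Inl x' @ map Inr y' @ v'" "next_phase p l = Sharp \<longrightarrow> y' = []"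
      by blast
    have "run_weight st wt q0 w = n + wt q l + run_weight st wt (st q l) v'"
      using r read v by simp
    then show ?thesis unfolding pda_invariant_def using c' xy by blast
  qed
qed

lemma accepts_only_if:
  assumes "accepts_pair pda By_Empty_Stack (u, v)"
  shows "total_weight u v = 0"
proof -
  obtain w s where sh: "is_shuffle (end_marked u) (end_marked v) w"
    and run: "(two_tape_step pda)\<^sup>*\<^sup>* (w, [start_sym pda], start pda) ([], [], s)"
    using assms unfolding accepts_pair_def by auto
  have init: "pda_invariant w (w, [start_sym pda], start pda)"
    unfolding pda_invariant_def
    by (intro exI[of _ w] exI[of _ "[0]"] exI[of _ Sharp] exI[of _ q0]
        exI[of _ 0] exI[of _ 0] exI[of _ "[]"] exI[of _ "[]"]) (auto simp: pda_def counter_stack_def)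
  have "pda_invariant w ([], [], s)"
    using run by (induction rule: rtranclp_induct) (use init pda_invariant_step in auto)
  then obtain x y where w: "w = map Inl x @ map Inr y" and z: "run_weight st wt q0 w = 0"
    unfolding pda_invariant_def by (auto simp: counter_stack_def)
  show ?thesis using shuffle_in_sequence[OF sh[unfolded w]] w z by simp
qed

text \<open>If the automaton succeeds, the invariant at the end says that the shuffle is the sequential one and
  that its weight is \<open>0\<close>; conversely the sequential shuffle can be run through.\<close>

theorem two_tape_language_counter:
  "two_tape_language A {(u, v) \<in> lists A \<times> lists A. total_weight u v = 0}"
  unfolding two_tape_language_def
  by (intro exI[of _ pda] exI[of _ By_Empty_Stack])
    (use is_two_tape_pda accepts_if accepts_only_if in auto)

end

section \<open>Regular conditions\<close>

text \<open>Regular conditions on a single word occur in three roles: for pushdown automata that ignore their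
  stack, and for two-tape automata that look at only the first or only the second tape.\<close>

locale finite_automaton =
  fixes A :: "'a set" and Q :: "'q::countable set" and q0 :: 'q and st :: "'q \<Rightarrow> 'a \<Rightarrow> 'q" and F :: "'q set"
  assumes finite_A: "finite A" and finite_Q: "finite Q" and q0: "q0 \<in> Q"
    and st: "q \<in> Q \<Longrightarrow> x \<in> A \<Longrightarrow> st q x \<in> Q"
begin

definition language :: "'a list set" where
  "language = {w \<in> lists A. foldl st q0 w \<in> F}"

definition dfa_pda :: "('a, nat, nat) dpda" where
  "dfa_pda = \<lparr>states = to_nat ` Q, inputs = A, stack_syms = {0},
     delta = (\<lambda>(x, b, s). case x of None \<Rightarrow> None
       | Some a \<Rightarrow> if a \<in> A \<and> b = 0 \<and> s \<in> to_nat ` Q then Some (to_nat (st (from_nat s) a), [0]) else None),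
     start = to_nat q0, start_sym = 0, finals = to_nat ` (Q \<inter> F)\<rparr>"

lemma foldl_st: "w \<in> lists A \<Longrightarrow> q \<in> Q \<Longrightarrow> foldl st q w \<in> Q"
  by (induction w arbitrary: q) (auto intro: st)

lemma is_dpda_dfa_pda: "is_dpda dfa_pda"
  unfolding is_dpda_def using finite_A finite_Q q0 st
  by (auto simp: dfa_pda_def ran_def split: option.splits if_splits) 

theorem dpda_language: "dpda_language A language"
proof -
  let ?R = "\<lambda>c c'. \<exists>a. dpda_step dfa_pda a c c'"
  have run: "?R\<^sup>*\<^sup>* (w, [0], to_nat q) ([], [0], to_nat (foldl st q w))"
    if "w \<in> lists A" "q \<in> Q" for w q
    using that
  proof (induction arbitrary: q rule: lists.induct)
    case (Cons a w)
    note a = Cons.hyps(1)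
    have "delta dfa_pda (Some a, 0, to_nat q) = Some (to_nat (st q a), [0])"
      using Cons.prems a by (simp add: dfa_pda_def)
    from dpda_step.intros[OF this, of w "[]"]
    have "?R (a # w, [0], to_nat q) (w, [0], to_nat (st q a))" by auto
    moreover have "?R\<^sup>*\<^sup>* (w, [0], to_nat (st q a)) ([], [0], to_nat (foldl st (st q a) w))"
      using Cons.IH[of "st q a"] Cons.prems a st by simp
    ultimately show ?case by (simp add: converse_rtranclp_into_rtranclp)
  qed simp
  have inv: "\<exists>u. w = u @ fst c \<and> snd (snd c) = to_nat (foldl st q0 u)"
    if "?R\<^sup>*\<^sup>* (w, [0], to_nat q0) c" for w c
    using that
  proof (induction rule: rtranclp_induct)
    case base
    show ?case by (intro exI[of _ "[]"]) auto
  next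
    case (step c c')
    then obtain u where u: "w = u @ fst c" "snd (snd c) = to_nat (foldl st q0 u)" by blast
    obtain a where "dpda_step dfa_pda a c c'" using step by blast
    then show ?case
    proof cases
      case (1 b s t \<alpha> v y)
      then obtain l where "a = Some l" "t = to_nat (st (from_nat s) l)"
        by (auto simp: dfa_pda_def split: option.splits if_splits)
      then show ?thesis using u 1 by (intro exI[of _ "u @ [l]"]) auto
    qed
  qed
  have "accepts dfa_pda By_Final_State w \<longleftrightarrow> foldl st q0 w \<in> F" if w: "w \<in> lists A" for w
  proof
    assume "accepts dfa_pda By_Final_State w"
    then obtain z s where "?R\<^sup>*\<^sup>* (w, [0], to_nat q0) ([], z, s)" "s \<in> to_nat ` (Q \<inter> F)"
      unfolding accepts_def by (auto simp: dfa_pda_def)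
    then show "foldl st q0 w \<in> F" using inv by fastforce
  next
    assume "foldl st q0 w \<in> F"
    then show "accepts dfa_pda By_Final_State w"
      unfolding accepts_def using run[OF w q0] foldl_st[OF w q0]
      by (intro exI[of _ "([], [0], to_nat (foldl st q0 w))"]) (auto simp: dfa_pda_def)
  qed
  then show ?thesis unfolding dpda_language_def language_def
    using is_dpda_dfa_pda by (intro exI[of _ dfa_pda] exI[of _ By_Final_State])
      (auto simp: dfa_pda_def)
qed

theorem two_tape_language_sharp:
  "two_tape_language A {(u, v) \<in> lists A \<times> lists A. u \<in> language}"
proof -
  define st' where "st' = (\<lambda>q (x :: 'a two_tape_letter). case x of Inl (Letter a) \<Rightarrow> st q a | _ \<Rightarrow> q)"
  define wt where "wt = (\<lambda>q (x :: 'a two_tape_letter). if x = Inl Endmark \<and> q \<notin> F then 1 else 0 :: int)"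
  interpret counter_automaton A Q q0 st' wt
    by unfold_locales (auto simp: finite_A finite_Q q0 st'_def marked_alphabet_def
        intro: st split: sum.splits marked.splits)
  have 1: "run_weight st' wt q (map Inl (end_marked u) @ y) = (if foldl st q u \<in> F then 0 else 1)
        + run_weight st' wt (foldl st q u) y" for q u y
    by (induction u arbitrary: q) (auto simp: end_marked_def st'_def wt_def)
  have 2: "run_weight st' wt q (map Inr v) = 0" for q v
    by (induction v arbitrary: q) (auto simp: wt_def)
  have "total_weight u v = 0 \<longleftrightarrow> u \<in> language" if "u \<in> lists A" for u v
    unfolding 1 2 using that by (simp add: language_def)
  then have "{(u, v) \<in> lists A \<times> lists A. total_weight u v = 0} =
      {(u, v) \<in> lists A \<times> lists A. u \<in> language}"
    by (intro Collect_cong) (auto simp del: Cons_in_lists_iff)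
  with two_tape_language_counter show ?thesis by simp
qed

theorem two_tape_language_flat:
  "two_tape_language A {(u, v) \<in> lists A \<times> lists A. v \<in> language}"
proof -
  define st' where "st' = (\<lambda>q (x :: 'a two_tape_letter). case x of Inr (Letter a) \<Rightarrow> st q a | _ \<Rightarrow> q)"
  define wt where "wt = (\<lambda>q (x :: 'a two_tape_letter). if x = Inr Endmark \<and> q \<notin> F then 1 else 0 :: int)"
  interpret counter_automaton A Q q0 st' wt
    by unfold_locales (auto simp: finite_A finite_Q q0 st'_def marked_alphabet_def
        intro: st split: sum.splits marked.splits)
  have 1: "run_weight st' wt q (map Inl u @ y) = run_weight st' wt q y" for q u y
    by (induction u arbitrary: q) (auto simp: st'_def wt_def)
  have 2: "run_weight st' wt q (map Inr (end_marked v)) = (if foldl st q v \<in> F then 0 else 1)" for q v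
    by (induction v arbitrary: q) (auto simp: end_marked_def st'_def wt_def)
  have "total_weight u v = 0 \<longleftrightarrow> v \<in> language" if "v \<in> lists A" for u v
    unfolding 1 2 using that by (simp add: language_def)
  then have "{(u, v) \<in> lists A \<times> lists A. total_weight u v = 0} =
      {(u, v) \<in> lists A \<times> lists A. v \<in> language}"
    by (intro Collect_cong) (auto simp del: Cons_in_lists_iff)
  with two_tape_language_counter show ?thesis by simp
qed

end

text \<open>In a local language membership depends only on the first letter and on pairs of adjacent letters. An
  automaton for it remembers the last letter; \<open>None\<close> is its start state and \<open>Some None\<close> its
  dead state.\<close>

fun local_step :: "'a set \<Rightarrow> ('a \<Rightarrow> 'a \<Rightarrow> bool) \<Rightarrow> 'a option option \<Rightarrow> 'a \<Rightarrow> 'a option option" where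
  "local_step I R None x = Some (if x \<in> I then Some x else None)"
| "local_step I R (Some None) x = Some None"
| "local_step I R (Some (Some y)) x = Some (if R y x then Some x else None)"

definition local_language :: "'a set \<Rightarrow> 'a set \<Rightarrow> ('a \<Rightarrow> 'a \<Rightarrow> bool) \<Rightarrow> 'a list set" where
  "local_language A I R = {w \<in> lists A. w \<noteq> [] \<and> hd w \<in> I \<and> successively R w}"

lemma local_automaton:
  fixes A :: "'a::countable set"
  assumes "finite A"
  shows "finite_automaton A ({None, Some None} \<union> Some ` Some ` A) None (local_step I R)"
    and "finite_automaton.language A None (local_step I R) (range (Some \<circ> Some)) = local_language A I R"
proof -
  interpret finite_automaton A "{None, Some None} \<union> Some ` Some ` A" None "local_step I R"
      "range (Some \<circ> Some)"
    using assms by unfold_locales auto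
  show "finite_automaton A ({None, Some None} \<union> Some ` Some ` A) None (local_step I R)"
    by unfold_locales
  have dead: "foldl (local_step I R) (Some None) w = Some None" for w
    by (induction w) auto
  have live: "foldl (local_step I R) (Some (Some y)) w \<in> range (Some \<circ> Some) \<longleftrightarrow> successively R (y # w)"
    for y w
    by (induction w arbitrary: y) (auto simp: dead)
  have "foldl (local_step I R) None w \<in> range (Some \<circ> Some) \<longleftrightarrow>
      w \<noteq> [] \<and> hd w \<in> I \<and> successively R w" for w
    using live dead by (cases w) auto
  then show "language = local_language A I R"
    by (simp only: language_def local_language_def)
qed

section \<open>Words for normal forms\<close>

text \<open>The letters stand for coset representatives and for basis elements (\<open>True\<close>) and
  their inverses (\<open>False\<close>). They are encoded as numbers because the alphabet of a parallel poly-pushdown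
  structure consists of numbers.\<close>

datatype letter = Coset nat | Gen nat bool

instance letter :: countable by countable_datatype

abbreviation coset_letter :: "nat \<Rightarrow> nat" where
  "coset_letter t \<equiv> to_nat (Coset t)"

abbreviation gen_letter :: "nat \<Rightarrow> bool \<Rightarrow> nat" where
  "gen_letter i s \<equiv> to_nat (Gen i s)"

definition nf_alphabet :: "nat \<Rightarrow> nat \<Rightarrow> nat set" where
  "nf_alphabet m d = coset_letter ` {..<m} \<union> case_prod gen_letter ` ({..<d} \<times> UNIV)"

definition exponent_block :: "(nat \<Rightarrow> int) \<Rightarrow> nat \<Rightarrow> nat list" where
  "exponent_block e i = replicate (nat \<bar>e i\<bar>) (gen_letter i (e i > 0))"

definition exponent_word :: "nat \<Rightarrow> (nat \<Rightarrow> int) \<Rightarrow> nat list" where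
  "exponent_word d e = concat (map (exponent_block e) [0..<d])"

text \<open>The coset letter comes first: an automaton that reads it can choose the coefficients
  for the exponents that follow.\<close>

definition normal_word :: "nat \<Rightarrow> nat \<Rightarrow> (nat \<Rightarrow> int) \<Rightarrow> nat list" where
  "normal_word d t e = coset_letter t # exponent_word d e"

definition normal_words :: "nat \<Rightarrow> nat \<Rightarrow> nat list set" where
  "normal_words m d = {normal_word d t e | t e. t < m}"

lemma finite_nf_alphabet: "finite (nf_alphabet m d)"
  by (simp add: nf_alphabet_def)

lemma exponent_word_Suc: "exponent_word (Suc d) e = exponent_word d e @ exponent_block e d"
  by (simp add: exponent_word_def)

lemma set_exponent_word: "set (exponent_word d e) \<subseteq> {gen_letter i s | i s. i < d}"
  by (auto simp: exponent_word_def exponent_block_def split: if_splits)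

lemma normal_word_in_lists: "t < m \<Longrightarrow> normal_word d t e \<in> lists (nf_alphabet m d)"
proof -
  assume "t < m"
  moreover have "x \<in> nf_alphabet m d" if "x \<in> set (exponent_word d e)" for x
  proof -
    have "x \<in> {gen_letter i s | i s. i < d}" using set_exponent_word that by (rule subsetD)
    then show ?thesis by (auto simp: nf_alphabet_def)
  qed
  ultimately show ?thesis by (auto simp: normal_word_def nf_alphabet_def)
qed

text \<open>The condition on adjacent letters that singles out the normal words: exponent blocks come in order
  of their indices, and inside a block the sign does not change.\<close>

definition may_follow :: "nat \<Rightarrow> nat \<Rightarrow> bool" where
  "may_follow x y \<longleftrightarrow> (case from_nat y of Coset _ \<Rightarrow> False
     | Gen j s \<Rightarrow> (case from_nat x of Coset _ \<Rightarrow> True | Gen i r \<Rightarrow> i < j \<or> i = j \<and> r = s))"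

lemma may_follow_simps [simp]:
  "\<not> may_follow x (coset_letter t)"
  "may_follow (coset_letter t) (gen_letter j s)"
  "may_follow (gen_letter i r) (gen_letter j s) \<longleftrightarrow> i < j \<or> i = j \<and> r = s"
  by (auto simp: may_follow_def)

lemma successively_replicate: "(R x x) \<Longrightarrow> successively R (replicate n x)"
  by (induction n rule: induct_nat_012) auto

lemma successively_exponent_word: "successively may_follow (exponent_word d e)"
proof (induction d)
  case 0
  then show ?case by (simp add: exponent_word_def)
next
  case (Suc d)
  have "may_follow (last (exponent_word d e)) (hd (exponent_block e d))"
    if "exponent_word d e \<noteq> []" "exponent_block e d \<noteq> []"
  proof -
    have "last (exponent_word d e) \<in> {gen_letter i s | i s. i < d}"
      using set_exponent_word last_in_set[OF that(1)] by (rule subsetD)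
    then obtain i s where "last (exponent_word d e) = gen_letter i s" "i < d" by auto
    then show ?thesis using that(2) by (auto simp: exponent_block_def)
  qed
  moreover have "successively may_follow (exponent_block e d)"
    unfolding exponent_block_def by (rule successively_replicate) simp
  ultimately show ?case
    using Suc unfolding exponent_word_Suc successively_append_iff by blast
qed

lemma exponent_word_split:
  assumes "i < d" "\<forall>k<i. e k = 0"
  shows "exponent_word d e = exponent_block e i @ concat (map (exponent_block e) [Suc i..<d])"
proof -
  have "[0..<d] = [0..<i] @ i # [Suc i..<d]"
    using assms(1) by (metis upt_add_eq_append upt_conv_Cons le_add1 less_imp_add_positive zero_le add.left_neutral)
  moreover have "concat (map (exponent_block e) [0..<i]) = []"
    using assms(2) by (auto simp: exponent_block_def)
  ultimately show ?thesis by (simp add: exponent_word_def)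
qed

text \<open>This is the induction step for recovering exponents from a word: a letter put in front of a word
  without smaller indices, and without the opposite sign at its own index, changes one exponent by a unit.\<close>

lemma exponent_word_prepend:
  assumes "i < d" "\<forall>k<i. e k = 0" "e i = 0 \<or> (e i > 0 \<longleftrightarrow> s)"
  shows "exponent_word d (e(i := e i + (if s then 1 else - 1))) = gen_letter i s # exponent_word d e"
proof -
  define e' where "e' = e(i := e i + (if s then 1 else - 1))"
  have "exponent_block e' i = gen_letter i s # exponent_block e i"
  proof -
    have "nat \<bar>e' i\<bar> = Suc (nat \<bar>e i\<bar>)" "e' i > 0 \<longleftrightarrow> s" using assms(3) by (auto simp: e'_def)
    then show ?thesis using assms(3) by (auto simp: exponent_block_def)
  qed
  moreover have "map (exponent_block e') [Suc i..<d] = map (exponent_block e) [Suc i..<d]"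
    by (auto simp: e'_def exponent_block_def)
  moreover have "\<forall>k<i. e' k = 0" using assms(2) by (simp add: e'_def)
  ultimately show ?thesis
    using exponent_word_split[of i d e] exponent_word_split[of i d e'] assms(1,2)
    unfolding e'_def[symmetric] by (simp del: map_eq_conv)
qed

lemma exponent_word_if_successively:
  assumes "successively may_follow (gen_letter i s # v)" "i < d" "v \<in> lists (nf_alphabet m d)"
  shows "\<exists>e. gen_letter i s # v = exponent_word d e \<and> (\<forall>k<i. e k = 0) \<and> e i \<noteq> 0 \<and> (e i > 0 \<longleftrightarrow> s)"
  using assms
proof (induction v arbitrary: i s)
  case Nil
  have "exponent_word d (\<lambda>_. 0) = []" by (simp add: exponent_word_def exponent_block_def)
  then show ?case using exponent_word_prepend[of i d "\<lambda>_. 0" s] Nil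
    by (intro exI[of _ "(\<lambda>_. 0)(i := 0 + (if s then 1 else - 1))"])
      (simp del: fun_upd_apply, simp)
next
  case (Cons x v)
  have xA: "x \<in> nf_alphabet m d" and v: "v \<in> lists (nf_alphabet m d)" using Cons.prems(3) by auto
  have f: "may_follow (gen_letter i s) x" "successively may_follow (x # v)"
    using Cons.prems(1) by auto
  obtain j r where x: "x = gen_letter j r" "j < d"
    using xA f(1) unfolding nf_alphabet_def by auto
  obtain e where e: "x # v = exponent_word d e" "\<forall>k<j. e k = 0" "e j \<noteq> 0" "e j > 0 \<longleftrightarrow> r"
    using Cons.IH[of j r] f(2) v x by auto
  have ij: "i < j \<or> i = j \<and> s = r" using f(1) x by simp
  have "gen_letter i s # x # v = exponent_word d (e(i := e i + (if s then 1 else - 1)))"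
    using exponent_word_prepend[of i d e s] ij e Cons.prems(2) by auto
  moreover have "e i = 0 \<or> (e i > 0 \<longleftrightarrow> s)" using ij e by auto
  moreover have "\<forall>k<i. (e(i := e i + (if s then 1 else - 1))) k = 0" using ij e(2) by auto
  moreover have "(e(i := e i + (if s then 1 else - 1))) i \<noteq> 0"
    "(e(i := e i + (if s then 1 else - 1))) i > 0 \<longleftrightarrow> s"
    using \<open>e i = 0 \<or> (e i > 0 \<longleftrightarrow> s)\<close> by auto
  ultimately show ?case by blast
qed

lemma normal_words_local:
  "normal_words m d = local_language (nf_alphabet m d) (range coset_letter) may_follow"
proof (intro subset_antisym subsetI)
  fix w assume "w \<in> normal_words m d"
  then obtain t e where w: "w = normal_word d t e" "t < m" unfolding normal_words_def by blast
  have "may_follow (coset_letter t) (hd (exponent_word d e))" if "exponent_word d e \<noteq> []"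
  proof -
    have "hd (exponent_word d e) \<in> {gen_letter i s | i s. i < d}"
      using set_exponent_word hd_in_set[OF that] by (rule subsetD)
    then show ?thesis by auto
  qed
  then have "successively may_follow w"
    using successively_exponent_word[of d e] unfolding w normal_word_def
    by (cases "exponent_word d e") auto
  then show "w \<in> local_language (nf_alphabet m d) (range coset_letter) may_follow"
    using normal_word_in_lists[OF w(2)] unfolding local_language_def w
    by (auto simp: normal_word_def)
next
  fix w assume "w \<in> local_language (nf_alphabet m d) (range coset_letter) may_follow"
  then obtain t v where w: "w = coset_letter t # v" and A: "w \<in> lists (nf_alphabet m d)"
    and s: "successively may_follow w"
    unfolding local_language_def by (cases w) auto
  have t: "t < m" using A unfolding w nf_alphabet_def by auto
  have "\<exists>e. v = exponent_word d e"
  proof (cases v)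
    case Nil
    then show ?thesis by (intro exI[of _ "\<lambda>_. 0"]) (simp add: exponent_word_def exponent_block_def)
  next
    case (Cons x v')
    then have x: "x \<in> nf_alphabet m d" "v' \<in> lists (nf_alphabet m d)" "may_follow (coset_letter t) x"
        "successively may_follow (x # v')"
      using A s unfolding w by auto
    then obtain i r where "x = gen_letter i r" "i < d" unfolding nf_alphabet_def by auto
    then show ?thesis using exponent_word_if_successively x Cons by blast
  qed
  then show "w \<in> normal_words m d" unfolding normal_words_def normal_word_def w using t by blast
qed

section \<open>Affine equations between normal words\<close>

text \<open>The state remembers the first coset letter of the first tape; later letters do not change it.\<close>

fun coset_state :: "nat \<Rightarrow> nat option \<Rightarrow> nat two_tape_letter \<Rightarrow> nat option" where
  "coset_state m None (Inl (Letter l)) = (case from_nat l of Coset t \<Rightarrow> if t < m then Some t else None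
      | _ \<Rightarrow> None)"
| "coset_state m q _ = q"

text \<open>Letters for a basis element and for its inverse have opposite weights, so the total weight of an
  exponent block is a multiple of its exponent. The constant term is charged at the end marker of the first tape. The second tape enters with the
  opposite sign.\<close>

fun affine_weight :: "(nat \<Rightarrow> nat \<Rightarrow> int) \<Rightarrow> (nat \<Rightarrow> int) \<Rightarrow> (nat \<Rightarrow> int) \<Rightarrow> (nat \<Rightarrow> int)
    \<Rightarrow> nat option \<Rightarrow> nat two_tape_letter \<Rightarrow> int" where
  "affine_weight M c \<beta> \<gamma> None (Inl _) = 0"
| "affine_weight M c \<beta> \<gamma> (Some t) (Inl Endmark) = c t"
| "affine_weight M c \<beta> \<gamma> (Some t) (Inl (Letter l)) =
     (case from_nat l of Coset _ \<Rightarrow> 0 | Gen i s \<Rightarrow> if s then M t i else - M t i)"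
| "affine_weight M c \<beta> \<gamma> q (Inr Endmark) = 0"
| "affine_weight M c \<beta> \<gamma> q (Inr (Letter l)) =
     (case from_nat l of Coset t \<Rightarrow> - \<gamma> t | Gen i s \<Rightarrow> if s then - \<beta> i else \<beta> i)"

text \<open>Intersected with the pairs of normal words, this becomes the solution set of one affine equation.\<close>

definition affine_solutions :: "nat \<Rightarrow> nat \<Rightarrow> (nat \<Rightarrow> nat \<Rightarrow> int) \<Rightarrow> (nat \<Rightarrow> int) \<Rightarrow> (nat \<Rightarrow> int)
    \<Rightarrow> (nat \<Rightarrow> int) \<Rightarrow> (nat list \<times> nat list) set" where
  "affine_solutions m d M c \<beta> \<gamma> = {(u, v) \<in> lists (nf_alphabet m d) \<times> lists (nf_alphabet m d).
     run_weight (coset_state m) (affine_weight M c \<beta> \<gamma>) None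
       (map Inl (end_marked u) @ map Inr (end_marked v)) = 0}"

lemma two_tape_language_affine_solutions:
  "two_tape_language (nf_alphabet m d) (affine_solutions m d M c \<beta> \<gamma>)"
proof -
  interpret counter_automaton "nf_alphabet m d" "insert None (Some ` {..<m})" None "coset_state m"
      "affine_weight M c \<beta> \<gamma>"
  proof
    fix q x assume "q \<in> insert None (Some ` {..<m})"
    then show "coset_state m q x \<in> insert None (Some ` {..<m})"
      by (cases "(m, q, x)" rule: coset_state.cases) (auto split: letter.splits)
  qed (auto simp: finite_nf_alphabet)
  show ?thesis unfolding affine_solutions_def by (rule two_tape_language_counter)
qed

lemma run_weight_constant_state:
  "(\<And>x. x \<in> set xs \<Longrightarrow> st q x = q) \<Longrightarrow>
     run_weight st wt q xs = sum_list (map (wt q) xs) \<and> foldl st q xs = q"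
  by (induction xs) auto

lemma sum_list_exponent_word:
  fixes f :: "nat \<Rightarrow> int"
  assumes "\<And>i s. f (gen_letter i s) = (if s then a i else - a i)"
  shows "sum_list (map f (exponent_word d e)) = (\<Sum>i<d. a i * e i)"
proof (induction d)
  case (Suc d)
  have "sum_list (map f (exponent_block e d)) = a d * e d"
    by (auto simp: exponent_block_def assms sum_list_replicate)
  then show ?case using Suc by (simp add: exponent_word_Suc)
qed (simp add: exponent_word_def)

lemma normal_words_in_affine_solutions:
  assumes "t < m" "t' < m"
  shows "(normal_word d t e, normal_word d t' e') \<in> affine_solutions m d M c \<beta> \<gamma> \<longleftrightarrow>
     (\<Sum>i<d. M t i * e i) + c t = (\<Sum>i<d. \<beta> i * e' i) + \<gamma> t'"
proof -
  let ?st = "coset_state m" and ?wt = "affine_weight M c \<beta> \<gamma>"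
  let ?xs = "map Inl (map Letter (exponent_word d e)) @ [Inl Endmark] @ [Inr (Letter (coset_letter t'))]
    @ map Inr (map Letter (exponent_word d e')) @ [Inr Endmark]"
  have w: "map Inl (end_marked (normal_word d t e)) @ map Inr (end_marked (normal_word d t' e')) =
     Inl (Letter (coset_letter t)) # ?xs"
    by (simp add: end_marked_def normal_word_def)
  have "sum_list (map (\<lambda>l. ?wt (Some t) (Inl (Letter l))) (exponent_word d e)) = (\<Sum>i<d. M t i * e i)"
    "sum_list (map (\<lambda>l. ?wt (Some t) (Inr (Letter l))) (exponent_word d e')) = (\<Sum>i<d. - \<beta> i * e' i)"
    by (rule sum_list_exponent_word; simp)+
  moreover have "run_weight ?st ?wt (Some t) ?xs = sum_list (map (?wt (Some t)) ?xs)"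
    by (rule conjunct1[OF run_weight_constant_state]) simp
  ultimately have "run_weight ?st ?wt (Some t) ?xs =
      (\<Sum>i<d. M t i * e i) + c t - \<gamma> t' - (\<Sum>i<d. \<beta> i * e' i)"
    by (simp add: comp_def sum_negf)
  moreover have "run_weight ?st ?wt None (Inl (Letter (coset_letter t)) # ?xs) =
      run_weight ?st ?wt (Some t) ?xs"
    using assms(1) by simp
  ultimately have "run_weight ?st ?wt None
      (map Inl (end_marked (normal_word d t e)) @ map Inr (end_marked (normal_word d t' e'))) =
      (\<Sum>i<d. M t i * e i) + c t - \<gamma> t' - (\<Sum>i<d. \<beta> i * e' i)"
    unfolding w by (simp only:)
  then show ?thesis unfolding affine_solutions_def
    using normal_word_in_lists assms by simp linarith
qed

section \<open>Groups with an affine normal form\<close>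

primrec power_product :: "('g, 'm) monoid_scheme \<Rightarrow> (nat \<Rightarrow> 'g) \<Rightarrow> nat \<Rightarrow> (nat \<Rightarrow> int) \<Rightarrow> 'g" where
  "power_product G h 0 e = \<one>\<^bsub>G\<^esub>"
| "power_product G h (Suc d) e = power_product G h d e \<otimes>\<^bsub>G\<^esub> h d [^]\<^bsub>G\<^esub> e d"

lemma power_product_cong: "\<forall>i<d. e i = e' i \<Longrightarrow> power_product G h d e = power_product G h d e'"
  by (induction d) auto

definition letter_value :: "('g, 'm) monoid_scheme \<Rightarrow> (nat \<Rightarrow> 'g) \<Rightarrow> (nat \<Rightarrow> 'g) \<Rightarrow> nat \<Rightarrow> 'g" where
  "letter_value G r h l = (case from_nat l of Coset t \<Rightarrow> r t
     | Gen i s \<Rightarrow> if s then h i else inv\<^bsub>G\<^esub> h i)"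

context group
begin

lemma word_value_closed: "\<phi> ` set w \<subseteq> carrier G \<Longrightarrow> word_value G \<phi> w \<in> carrier G"
  by (induction w) (auto simp: word_value_def)

lemma word_value_append:
  "\<phi> ` set u \<subseteq> carrier G \<Longrightarrow> \<phi> ` set v \<subseteq> carrier G \<Longrightarrow>
     word_value G \<phi> (u @ v) = word_value G \<phi> u \<otimes> word_value G \<phi> v"
  using word_value_closed[of \<phi>]
  by (induction u) (auto simp: word_value_def m_assoc image_subset_iff)

lemma word_value_replicate:
  "\<phi> x \<in> carrier G \<Longrightarrow> word_value G \<phi> (replicate n x) = \<phi> x [^] n"
  by (induction n) (auto simp: word_value_def nat_pow_Suc2[symmetric])

lemma word_value_exponent_word:
  assumes "\<And>i. i < d \<Longrightarrow> h i \<in> carrier G"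
  shows "word_value G (letter_value G r h) (exponent_word d e) = power_product G h d e"
  using assms
proof (induction d)
  case (Suc d)
  have h: "h d \<in> carrier G" using Suc.prems by simp
  have "word_value G (letter_value G r h) (exponent_block e d) = h d [^] e d"
  proof (cases "e d > 0")
    case True
    then have "word_value G (letter_value G r h) (exponent_block e d) = h d [^] nat (e d)"
      using h by (simp add: exponent_block_def word_value_replicate letter_value_def)
    then show ?thesis using True int_pow_int[of G "h d" "nat (e d)"] by simp
  next
    case False
    then obtain n where n: "e d = - int n" by (metis linorder_not_less nonpos_int_cases)
    then have "word_value G (letter_value G r h) (exponent_block e d) = inv h d [^] n"
      using h by (simp add: exponent_block_def word_value_replicate letter_value_def)
    also have "\<dots> = h d [^] e d"
      unfolding n int_pow_neg_int[OF h] by (rule nat_pow_inv[OF h])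
    finally show ?thesis .
  qed
  moreover have "letter_value G r h ` set (exponent_word d e) \<subseteq> carrier G"
  proof -
    have "letter_value G r h x \<in> carrier G" if "x \<in> set (exponent_word d e)" for x
    proof -
      have "x \<in> {gen_letter i s | i s. i < d}" using set_exponent_word that by (rule subsetD)
      then show ?thesis using Suc.prems by (auto simp: letter_value_def)
    qed
    then show ?thesis by blast
  qed
  moreover have "letter_value G r h ` set (exponent_block e d) \<subseteq> carrier G"
    using h by (auto simp: letter_value_def exponent_block_def)
  ultimately show ?case using Suc by (simp add: exponent_word_Suc word_value_append)
qed (simp add: exponent_word_def word_value_def)

text \<open>The exponents of a product with a fixed element are affine functions of the exponents, with
  coefficients depending on the coset. So multiplication by a letter is described by finitely many affine
  equations: one for each exponent, and one more that compares the indices of the cosets. Each of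
  them is checked by its own counter, and the normal words themselves form a local language.\<close>

theorem P_group_if_affine_normal_form:
  fixes d m :: nat
  assumes h: "\<And>i. i < d \<Longrightarrow> h i \<in> carrier G" and r: "\<And>t. t < m \<Longrightarrow> r t \<in> carrier G"
    and surj: "\<And>g. g \<in> carrier G \<Longrightarrow> \<exists>t<m. \<exists>e. g = r t \<otimes> power_product G h d e"
    and inj: "\<And>t t' e e'. t < m \<Longrightarrow> t' < m \<Longrightarrow>
        r t \<otimes> power_product G h d e = r t' \<otimes> power_product G h d e' \<Longrightarrow> t = t' \<and> (\<forall>i<d. e i = e' i)"
    and affine: "\<And>g t. g \<in> carrier G \<Longrightarrow> t < m \<Longrightarrow> \<exists>t'<m. \<exists>c M. \<forall>e.
        r t \<otimes> power_product G h d e \<otimes> g =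
        r t' \<otimes> power_product G h d (\<lambda>k. (\<Sum>i<d. M k i * e i) + c k)"
  shows "P_group G"
proof -
  let ?A = "nf_alphabet m d" and ?L = "normal_words m d" and ?\<phi> = "letter_value G r h"
  have \<phi>A: "?\<phi> ` ?A \<subseteq> carrier G"
    using h r by (auto simp: nf_alphabet_def letter_value_def)
  have LA: "?L \<subseteq> lists ?A" using normal_word_in_lists unfolding normal_words_def by blast
  have val: "word_value G ?\<phi> (normal_word d t e) = r t \<otimes> power_product G h d e" for t e
    using word_value_exponent_word[of d h r e] h
    by (simp add: normal_word_def) (simp add: word_value_def letter_value_def)
  have "word_value G ?\<phi> ` ?L = carrier G"
  proof
    show "word_value G ?\<phi> ` ?L \<subseteq> carrier G"
      using LA \<phi>A word_value_closed[of ?\<phi>] by blast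
    show "carrier G \<subseteq> word_value G ?\<phi> ` ?L"
    proof
      fix g assume "g \<in> carrier G"
      then obtain t e where "t < m" "g = r t \<otimes> power_product G h d e" using surj by blast
      then show "g \<in> word_value G ?\<phi> ` ?L"
        unfolding val[symmetric] normal_words_def by blast
    qed
  qed
  moreover have "inj_on (word_value G ?\<phi>) ?L"
  proof
    fix w w' assume "w \<in> ?L" "w' \<in> ?L" and eq: "word_value G ?\<phi> w = word_value G ?\<phi> w'"
    then obtain t e t' e' where w: "w = normal_word d t e" "w' = normal_word d t' e'" "t < m" "t' < m"
      unfolding normal_words_def by blast
    then have "t = t'" "\<forall>i<d. e i = e' i"
      using inj[of t t' e e'] eq unfolding w val by auto
    then show "w = w'" unfolding w normal_word_def exponent_word_def
      by (auto simp: exponent_block_def intro!: arg_cong[where f = concat])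
  qed
  ultimately have bij: "bij_betw (word_value G ?\<phi>) ?L (carrier G)"
    by (simp add: bij_betw_def)
  interpret L: finite_automaton ?A "{None, Some None} \<union> Some ` Some ` ?A" None
      "local_step (range coset_letter) may_follow" "range (Some \<circ> Some)"
    by (rule local_automaton(1)[OF finite_nf_alphabet])
  have L: "L.language = ?L"
    unfolding normal_words_local by (rule local_automaton(2)[OF finite_nf_alphabet])
  have PL: "P_language ?A ?L"
    unfolding P_language_def using L.dpda_language unfolding L
    by (intro exI[of _ "{?L}"]) auto
  have ATP: "ATP_relation ?A {(w, w'). w \<in> ?L \<and> w' \<in> ?L \<and>
      word_value G ?\<phi> w' = word_value G ?\<phi> (w @ [a])}" (is "ATP_relation _ ?R") if a: "a \<in> ?A" for a
  proof -
    have g: "?\<phi> a \<in> carrier G" using a \<phi>A by auto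
    have "\<forall>t. \<exists>x. t < m \<longrightarrow> fst x < m \<and> (\<forall>e. r t \<otimes> power_product G h d e \<otimes> ?\<phi> a =
        r (fst x) \<otimes> power_product G h d (\<lambda>k. (\<Sum>i<d. snd (snd x) k i * e i) + fst (snd x) k))"
    proof
      fix t
      show "\<exists>x. t < m \<longrightarrow> fst x < m \<and> (\<forall>e. r t \<otimes> power_product G h d e \<otimes> ?\<phi> a =
        r (fst x) \<otimes> power_product G h d (\<lambda>k. (\<Sum>i<d. snd (snd x) k i * e i) + fst (snd x) k))"
        using affine[OF g, of t] by (cases "t < m") (force, simp)
    qed
    then obtain f where f: "\<And>t. t < m \<Longrightarrow> fst (f t) < m \<and> (\<forall>e. r t \<otimes> power_product G h d e \<otimes> ?\<phi> a =
        r (fst (f t)) \<otimes> power_product G h d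
          (\<lambda>k. (\<Sum>i<d. snd (snd (f t)) k i * e i) + fst (snd (f t)) k))"
      unfolding choice_iff by blast
    define \<tau> where "\<tau> t = fst (f t)" for t
    define c where "c t = fst (snd (f t))" for t
    define M where "M t = snd (snd (f t))" for t
    have \<tau>: "\<And>t. t < m \<Longrightarrow> \<tau> t < m"
      and aff: "\<And>t e. t < m \<Longrightarrow> r t \<otimes> power_product G h d e \<otimes> ?\<phi> a =
        r (\<tau> t) \<otimes> power_product G h d (\<lambda>k. (\<Sum>i<d. M t k i * e i) + c t k)"
      using f unfolding \<tau>_def c_def M_def by blast+
    \<comment> \<open>The equation \<open>\<tau> t = t'\<close> is affine too: it has no exponents, only constants.\<close>
    define match where "match = affine_solutions m d (\<lambda>_ _. 0) (\<lambda>t. int (\<tau> t)) (\<lambda>_. 0) int"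
    define coordinate where "coordinate k =
      affine_solutions m d (\<lambda>t. M t k) (\<lambda>t. c t k) (\<lambda>i. of_bool (i = k)) (\<lambda>_. 0)" for k
    define \<R> where "\<R> = {{(u, v) \<in> lists ?A \<times> lists ?A. u \<in> ?L}, {(u, v) \<in> lists ?A \<times> lists ?A. v \<in> ?L},
      match} \<union> coordinate ` {..<d}"
    have "two_tape_language ?A match" "\<And>k. two_tape_language ?A (coordinate k)"
      unfolding match_def coordinate_def by (rule two_tape_language_affine_solutions)+
    then have "\<forall>Q \<in> \<R>. two_tape_language ?A Q"
      using L.two_tape_language_sharp L.two_tape_language_flat unfolding L \<R>_def by simp
    moreover
    have "(w, w') \<in> ?R \<longleftrightarrow> (w, w') \<in> \<Inter>\<R>" for w w'
    proof (cases "w \<in> ?L \<and> w' \<in> ?L")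
      case True
      then obtain t e t' e' where w: "w = normal_word d t e" "w' = normal_word d t' e'" "t < m" "t' < m"
        unfolding normal_words_def by blast
      have delta: "(\<Sum>i<d. of_bool (i = k) * e' i) = e' k" if "k < d" for k
        using that by (simp add: of_bool_def if_distrib[where f = "\<lambda>x. x * _"] cong: if_cong)
      have "word_value G ?\<phi> (w @ [a]) = word_value G ?\<phi> w \<otimes> word_value G ?\<phi> [a]"
        using True LA \<phi>A a by (intro word_value_append) auto
      also have "\<dots> = r t \<otimes> power_product G h d e \<otimes> ?\<phi> a"
        using g by (simp add: w val) (simp add: word_value_def)
      finally have "(w, w') \<in> ?R \<longleftrightarrow> r t' \<otimes> power_product G h d e' =
          r (\<tau> t) \<otimes> power_product G h d (\<lambda>k. (\<Sum>i<d. M t k i * e i) + c t k)"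
        using True aff[OF w(3)] by (simp add: w val)
      also have "\<dots> \<longleftrightarrow> t' = \<tau> t \<and> (\<forall>k<d. e' k = (\<Sum>i<d. M t k i * e i) + c t k)"
      proof
        assume "r t' \<otimes> power_product G h d e' =
          r (\<tau> t) \<otimes> power_product G h d (\<lambda>k. (\<Sum>i<d. M t k i * e i) + c t k)"
        from inj[OF w(4) \<tau>[OF w(3)] this]
        show "t' = \<tau> t \<and> (\<forall>k<d. e' k = (\<Sum>i<d. M t k i * e i) + c t k)" by simp
      next
        assume *: "t' = \<tau> t \<and> (\<forall>k<d. e' k = (\<Sum>i<d. M t k i * e i) + c t k)"
        then have "power_product G h d e' = power_product G h d (\<lambda>k. (\<Sum>i<d. M t k i * e i) + c t k)"
          by (intro power_product_cong) simp
        with * show "r t' \<otimes> power_product G h d e' =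
          r (\<tau> t) \<otimes> power_product G h d (\<lambda>k. (\<Sum>i<d. M t k i * e i) + c t k)" by simp
      qed
      also have "\<dots> \<longleftrightarrow> (w, w') \<in> match \<and> (\<forall>k<d. (w, w') \<in> coordinate k)"
        unfolding match_def coordinate_def w
        unfolding normal_words_in_affine_solutions[OF w(3,4)] using delta by auto
      also have "\<dots> \<longleftrightarrow> (w, w') \<in> \<Inter>\<R>"
        using True subsetD[OF LA] unfolding \<R>_def by simp auto
      finally show ?thesis .
    qed (auto simp: \<R>_def)
    then have eq: "p \<in> ?R \<longleftrightarrow> p \<in> \<Inter>\<R>" for p by (cases p) (simp only:)
    have "?R = \<Inter>\<R>" by (rule Set.set_eqI) (rule eq)
    moreover have "finite \<R>" "\<R> \<noteq> {}" unfolding \<R>_def by simp_all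
    ultimately show ?thesis unfolding ATP_relation_def by blast
  qed
  have "word_value G ?\<phi> ` lists ?A = carrier G"
  proof
    show "word_value G ?\<phi> ` lists ?A \<subseteq> carrier G"
    proof (rule image_subsetI)
      fix w assume "w \<in> lists ?A"
      then have "?\<phi> ` set w \<subseteq> carrier G" using \<phi>A by (auto simp: lists_eq_set)
      then show "word_value G ?\<phi> w \<in> carrier G" by (rule word_value_closed)
    qed
    show "carrier G \<subseteq> word_value G ?\<phi> ` lists ?A"
      using image_mono[OF LA, of "word_value G ?\<phi>"] bij unfolding bij_betw_def by simp
  qed
  then have "monoid_generators G ?A ?\<phi>"
    unfolding monoid_generators_def using finite_nf_alphabet \<phi>A by blast
  moreover have "P_structure G ?A ?\<phi> ?L"
    unfolding P_structure_def by (intro conjI ballI LA bij PL ATP)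
  ultimately show ?thesis unfolding P_group_def using is_group by blast
qed

end

section \<open>Products of powers\<close>

context group
begin

lemma power_product_closed [simp, intro]:
  "(\<And>i. i < d \<Longrightarrow> h i \<in> carrier G) \<Longrightarrow> power_product G h d e \<in> carrier G"
  by (induction d) auto

lemma power_product_zero [simp]: "power_product G h d (\<lambda>_. 0) = \<one>"
  by (induction d) auto

lemma power_product_in_subgroup:
  assumes "subgroup K G" "\<And>i. i < d \<Longrightarrow> h i [^] e i \<in> K"
  shows "power_product G h d e \<in> K"
  using assms(2) by (induction d) (auto simp: subgroup.one_closed[OF assms(1)] subgroup.m_closed[OF assms(1)])

lemma power_product_one:
  "(\<And>i. i < d \<Longrightarrow> h i [^] e i = \<one>) \<Longrightarrow> power_product G h d e = \<one>"
  by (induction d) auto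

lemma power_product_unit_vector:
  assumes "\<And>i. i < d \<Longrightarrow> h i \<in> carrier G" "j < d"
  shows "power_product G h d (\<lambda>i. if i = j then k else 0) = h j [^] k"
  using assms
proof (induction d)
  case (Suc d)
  show ?case
  proof (cases "j = d")
    case True
    then have "power_product G h d (\<lambda>i. if i = j then k else 0) = \<one>"
      by (intro power_product_one) auto
    then show ?thesis using True Suc.prems by simp
  qed (use Suc in auto)
qed simp

lemma power_product_pow:
  "(\<And>i. i < d \<Longrightarrow> h i \<in> carrier G) \<Longrightarrow>
     power_product G (\<lambda>i. h i [^] (M :: int)) d e = power_product G h d (\<lambda>i. M * e i)"
  by (induction d) (auto simp: int_pow_pow)

lemma power_product_append:
  assumes "\<And>i. i < m + n \<Longrightarrow> h i \<in> carrier G"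
  shows "power_product G h (m + n) e =
     power_product G h m e \<otimes> power_product G (\<lambda>j. h (m + j)) n (\<lambda>j. e (m + j))"
  using assms
proof (induction n)
  case (Suc n)
  then show ?case by (simp add: m_assoc)
qed simp

end

lemma power_product_hom:
  assumes "group_hom G H \<pi>" "\<And>i. i < d \<Longrightarrow> h i \<in> carrier G"
  shows "\<pi> (power_product G h d e) = power_product H (\<lambda>i. \<pi> (h i)) d e"
proof -
  interpret group_hom G H \<pi> by fact
  show ?thesis using assms(2) by (induction d) (auto simp: hom_int_pow)
qed

lemma power_product_cong_base:
  "(\<And>i. i < d \<Longrightarrow> h i = h' i) \<Longrightarrow> power_product G h d e = power_product G h' d e"
  by (induction d) auto

context comm_group
begin

lemma power_product_mult:
  assumes "\<And>i. i < d \<Longrightarrow> h i \<in> carrier G"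
  shows "power_product G h d e \<otimes> power_product G h d f = power_product G h d (\<lambda>i. e i + f i)"
  using assms
proof (induction d)
  case (Suc d)
  have "power_product G h d e \<in> carrier G" "power_product G h d f \<in> carrier G" "h d \<in> carrier G"
    using Suc.prems by auto
  then have "power_product G h (Suc d) e \<otimes> power_product G h (Suc d) f =
      (power_product G h d e \<otimes> power_product G h d f) \<otimes> (h d [^] e d \<otimes> h d [^] f d)"
    by (simp add: m_ac)
  then show ?case using Suc by (simp add: int_pow_mult)
qed simp

lemma power_product_inv:
  assumes "\<And>i. i < d \<Longrightarrow> h i \<in> carrier G"
  shows "inv (power_product G h d e) = power_product G h d (\<lambda>i. - e i)"
proof (rule inv_equality)
  show "power_product G h d (\<lambda>i. - e i) \<otimes> power_product G h d e = \<one>"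
    using assms by (simp add: power_product_mult)
qed (use assms in auto)

lemma subgroup_power_products:
  assumes "\<And>i. i < d \<Longrightarrow> h i \<in> carrier G"
  shows "subgroup (range (power_product G h d)) G"
proof (rule subgroupI)
  show "range (power_product G h d) \<subseteq> carrier G" using assms by auto
  show "a \<otimes> b \<in> range (power_product G h d)"
    if "a \<in> range (power_product G h d)" "b \<in> range (power_product G h d)" for a b
    using that assms by (auto simp: power_product_mult)
  show "inv a \<in> range (power_product G h d)" if "a \<in> range (power_product G h d)" for a
    using that assms by (auto simp: power_product_inv)
qed auto

lemma generate_power_products:
  assumes "\<And>i. i < d \<Longrightarrow> h i \<in> carrier G"
  shows "generate G (h ` {..<d}) \<subseteq> range (power_product G h d)"
proof (rule generate_subgroup_incl[OF _ subgroup_power_products[OF assms]])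
  show "h ` {..<d} \<subseteq> range (power_product G h d)"
  proof
    fix g assume "g \<in> h ` {..<d}"
    then obtain j where "j < d" "g = h j" by auto
    then have "g = power_product G h d (\<lambda>i. if i = j then 1 else 0)"
      using assms by (simp add: power_product_unit_vector)
    then show "g \<in> range (power_product G h d)" by blast
  qed
qed

lemma power_product_pow_in_subgroup:
  assumes K: "subgroup K G" and h: "\<And>i. i < d \<Longrightarrow> h i \<in> carrier G" "\<And>i. i < d \<Longrightarrow> h i [^] (M :: int) \<in> K"
  shows "power_product G h d e [^] M \<in> K"
  using h
proof (induction d)
  case 0
  then show ?case using subgroup.one_closed[OF K] by simp
next
  case (Suc d)
  have c: "power_product G h d e \<in> carrier G" "h d [^] e d \<in> carrier G" using Suc.prems by auto
  have "(h d [^] e d) [^] M = (h d [^] M) [^] e d"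
    using Suc.prems(1) by (simp add: int_pow_pow mult.commute)
  then have "(h d [^] e d) [^] M \<in> K"
    using Suc.prems subgroup_int_pow_closed[OF K] by auto
  moreover have "power_product G h d e [^] M \<in> K" using Suc by auto
  ultimately show ?case
    using c by (simp add: int_pow_mult_distrib[OF m_comm] subgroup.m_closed[OF K])
qed

section \<open>Independent families in abelian groups\<close>

text \<open>Going through the family, an element is added if it is independent of those chosen so far.
  Otherwise some relation involves a nonzero power of it (the elements chosen before admit no relation
  among themselves), so that this power lies in the subgroup that they generate.\<close>

theorem maximal_independent_subfamily:
  fixes n :: nat
  assumes "\<And>i. i < n \<Longrightarrow> x i \<in> carrier G"
  obtains r s M where "\<And>i. i < r \<Longrightarrow> s i < n"
    and "\<And>e. power_product G (\<lambda>i. x (s i)) r e = \<one> \<Longrightarrow> \<forall>i<r. e i = 0"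
    and "(M :: int) > 0" and "\<And>i. i < n \<Longrightarrow> x i [^] M \<in> range (power_product G (\<lambda>i. x (s i)) r)"
proof -
  have "\<exists>r s. \<exists>M::int. (\<forall>i<r. s i < n) \<and>
      (\<forall>e. power_product G (\<lambda>i. x (s i)) r e = \<one> \<longrightarrow> (\<forall>i<r. e i = 0)) \<and>
      M > 0 \<and> (\<forall>i<n. x i [^] M \<in> range (power_product G (\<lambda>i. x (s i)) r))"
    using assms
  proof (induction n)
    case 0
    show ?case by (intro exI[of _ 0] exI[of _ id] exI[of _ 1]) auto
  next
    case (Suc n)
    then obtain r s M where s: "\<forall>i<r. s i < n"
      and ind: "\<forall>e. power_product G (\<lambda>i. x (s i)) r e = \<one> \<longrightarrow> (\<forall>i<r. e i = 0)"
      and M: "(M::int) > 0" "\<forall>i<n. x i [^] M \<in> range (power_product G (\<lambda>i. x (s i)) r)"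
      by (metis less_SucI)
    define y where "y = (\<lambda>i. x (s i))"
    have y: "y i \<in> carrier G" if "i < r" for i
      unfolding y_def using that s by (intro Suc.prems) (simp add: less_SucI)
    have xn: "x n \<in> carrier G" using Suc.prems by simp
    show ?case
    proof (cases "\<exists>e k. power_product G y r e \<otimes> x n [^] (k::int) = \<one> \<and> k \<noteq> 0")
      case True
      then obtain e k where ek: "power_product G y r e \<otimes> x n [^] (k::int) = \<one>" "k \<noteq> 0" by blast
      have S: "subgroup (range (power_product G y r)) G" using y by (rule subgroup_power_products)
      have "x n [^] k = inv (power_product G y r e)"
        using ek(1) y xn by (metis inv_equality int_pow_closed m_comm power_product_closed)
      then have "x n [^] k \<in> range (power_product G y r)"
        using subgroup.m_inv_closed[OF S] by auto
      \<comment> \<open>The exponent is chosen such that \<open>k * (sgn k * M)\<close> is a positive multiple of \<open>M\<close>.\<close>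
      then have "(x n [^] k) [^] (sgn k * M) \<in> range (power_product G y r)"
        by (rule subgroup_int_pow_closed[OF S])
      then have "x n [^] (\<bar>k\<bar> * M) \<in> range (power_product G y r)"
        using xn by (simp add: int_pow_pow abs_sgn mult.assoc)
      moreover have "x i [^] (\<bar>k\<bar> * M) \<in> range (power_product G y r)" if "i < n" for i
      proof -
        have "(x i [^] M) [^] \<bar>k\<bar> \<in> range (power_product G y r)"
          using M(2) that by (intro subgroup_int_pow_closed[OF S, of "x i [^] M"]) (simp add: y_def)
        then show ?thesis using that Suc.prems by (simp add: int_pow_pow mult.commute)
      qed
      ultimately have "\<forall>i<Suc n. x i [^] (\<bar>k\<bar> * M) \<in> range (power_product G y r)"
        by (simp add: less_Suc_eq)
      then show ?thesis using s ind M ek(2) unfolding y_def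
        by (intro exI[of _ r] exI[of _ s] exI[of _ "\<bar>k\<bar> * M"]) auto
    next
      case False
      \<comment> \<open>The new element is appended as the last member of the subfamily.\<close>
      define s' where "s' = s(r := n)"
      have y': "power_product G (\<lambda>i. x (s' i)) r e = power_product G y r e" for e
        by (rule power_product_cong_base) (simp add: s'_def y_def)
      have "\<forall>i<Suc r. e i = 0" if "power_product G (\<lambda>i. x (s' i)) (Suc r) e = \<one>" for e
      proof -
        have eq: "power_product G y r e \<otimes> x n [^] e r = \<one>"
          using that by (simp add: y') (simp add: s'_def)
        then have "e r = 0" using False by blast
        then show ?thesis using eq ind y by (simp add: y_def less_Suc_eq)
      qed
      moreover have "x i [^] M \<in> range (power_product G (\<lambda>i. x (s' i)) (Suc r))" if i: "i < Suc n" for i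
      proof (cases "i = n")
        case True
        have "power_product G (\<lambda>i. x (s' i)) (Suc r) (\<lambda>i. if i = r then M else 0) = x (s' r) [^] M"
          using Suc.prems s by (intro power_product_unit_vector) (auto simp: s'_def less_Suc_eq)
        then show ?thesis using True by (metis fun_upd_same rangeI s'_def)
      next
        case False
        then have "x i [^] M \<in> range (power_product G y r)"
          using i M(2) unfolding y_def by simp
        then obtain e where e: "x i [^] M = power_product G y r e" by auto
        have "power_product G (\<lambda>i. x (s' i)) (Suc r) (e(r := 0)) = power_product G y r (e(r := 0))"
          using y by (simp add: y')
        also have "\<dots> = power_product G y r e" by (rule power_product_cong) simp
        finally show ?thesis unfolding e by (metis rangeI)
      qed
      moreover have "\<forall>i<Suc r. s' i < Suc n" using s by (auto simp: s'_def less_Suc_eq)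
      ultimately show ?thesis using M(1)
        by (intro exI[of _ "Suc r"] exI[of _ s'] exI[of _ M]) auto
    qed
  qed
  then show thesis using that by blast
qed

lemma independent_unique:
  assumes "\<And>i. i < d \<Longrightarrow> h i \<in> carrier G"
    and "\<And>e. power_product G h d e = \<one> \<Longrightarrow> \<forall>i<d. e i = 0"
    and "power_product G h d e = power_product G h d f"
  shows "\<forall>i<d. e i = f i"
proof -
  have "power_product G h d (\<lambda>i. e i + - f i) = power_product G h d e \<otimes> inv (power_product G h d f)"
    using assms(1) by (simp add: power_product_inv power_product_mult)
  also have "\<dots> = \<one>" using assms(1) unfolding assms(3) by (intro r_inv) auto
  finally show ?thesis using assms(2) by fastforce
qed

end

context comm_group
begin

lemma power_product_power:
  assumes "\<And>i. i < d \<Longrightarrow> h i \<in> carrier G"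
  shows "power_product G h d e [^] (k :: int) = power_product G h d (\<lambda>i. e i * k)"
  using assms
proof (induction d)
  case (Suc d)
  have "power_product G h d e \<in> carrier G" "h d \<in> carrier G" using Suc.prems by auto
  then show ?case using Suc by (simp add: int_pow_mult_distrib[OF m_comm] int_pow_pow)
qed simp

text \<open>Substituting power products for the factors multiplies the exponents by a matrix. This is the source
  of the linear terms in the affine normal form.\<close>

lemma power_product_substitute:
  assumes h: "\<And>i. i < d \<Longrightarrow> h i \<in> carrier G" 
    and \<kappa>: "\<And>i. i < n \<Longrightarrow> \<kappa> i = power_product G h d (b i)"
  shows "power_product G \<kappa> n e = power_product G h d (\<lambda>j. \<Sum>i<n. b i j * e i)"
  using \<kappa>
proof (induction n)
  case (Suc n)
  then show ?case using h by (simp add: power_product_power power_product_mult)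
qed simp

end

section \<open>Collecting modulo a central subgroup\<close>

context group
begin

lemma power_product_restrict:
  assumes "subgroup K G" "\<And>i. i < d \<Longrightarrow> h i \<in> K"
  shows "power_product (G\<lparr>carrier := K\<rparr>) h d e = power_product G h d e"
proof -
  have "group_hom (G\<lparr>carrier := K\<rparr>) G id"
    using canonical_inj_is_hom[OF assms(1)] by (simp add: id_def)
  from power_product_hom[OF this, of d h e] assms(2) show ?thesis by simp
qed

text \<open>Conjugation by \<open>g\<close> is a homomorphism; it takes \<open>a\<close> to \<open>a \<otimes> k\<close>, whose powers can be computed
  since \<open>a\<close> and \<open>k\<close> commute.\<close>

lemma int_pow_commute:
  assumes "a \<in> carrier G" "g \<in> carrier G" "k \<in> carrier G"
    and "k \<otimes> a = a \<otimes> k" "a \<otimes> g = g \<otimes> a \<otimes> k"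
  shows "a [^] (e :: int) \<otimes> g = g \<otimes> a [^] e \<otimes> k [^] e"
proof -
  let ?c = "\<lambda>x. inv g \<otimes> x \<otimes> g"
  have "group_hom G G ?c"
  proof (unfold_locales, rule homI)
    fix x y assume "x \<in> carrier G" "y \<in> carrier G"
    then show "?c (x \<otimes> y) = ?c x \<otimes> ?c y"
      using assms(2) by (simp add: m_assoc) (simp add: m_assoc[symmetric])
  qed (use assms in auto)
  then interpret c: group_hom G G ?c .
  have "inv g \<otimes> a [^] e \<otimes> g = (inv g \<otimes> a \<otimes> g) [^] e"
    using c.hom_int_pow[OF assms(1)] by simp
  also have "inv g \<otimes> a \<otimes> g = a \<otimes> k"
    using assms by (simp add: m_assoc) (simp add: m_assoc[symmetric])
  also have "(a \<otimes> k) [^] e = a [^] e \<otimes> k [^] e"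
    using assms by (intro int_pow_mult_distrib) auto
  finally have "g \<otimes> (inv g \<otimes> a [^] e \<otimes> g) = g \<otimes> (a [^] e \<otimes> k [^] e)" by simp
  then show ?thesis
    using assms by (simp add: m_assoc[symmetric])
qed

text \<open>This is the commutator of the inverses of \<open>a\<close> and \<open>g\<close>, written in the form in which it appears when
  \<open>a\<close> is moved to the right past \<open>g\<close>.\<close>

definition swap_factor :: "'a \<Rightarrow> 'a \<Rightarrow> 'a" where
  "swap_factor a g = inv (g \<otimes> a) \<otimes> (a \<otimes> g)"

lemma swap_factor_eqI:
  assumes "a \<in> carrier G" "g \<in> carrier G" "k \<in> carrier G" "a \<otimes> g = g \<otimes> a \<otimes> k"
  shows "swap_factor a g = k"
  unfolding swap_factor_def using assms by (subst inv_solve_left') auto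

lemma swap_factor: "a \<in> carrier G \<Longrightarrow> g \<in> carrier G \<Longrightarrow> a \<otimes> g = g \<otimes> a \<otimes> swap_factor a g"
  by (simp add: swap_factor_def m_assoc[symmetric])

end

locale central_subgroup = group G for G (structure) +
  fixes Z
  assumes Z: "subgroup Z G"
    and central: "z \<in> Z \<Longrightarrow> g \<in> carrier G \<Longrightarrow> z \<otimes> g = g \<otimes> z"
begin

lemma Z_carrier [simp, intro]: "z \<in> Z \<Longrightarrow> z \<in> carrier G"
  using subgroup.mem_carrier[OF Z] .

lemma comm_group_Z: "comm_group (G\<lparr>carrier := Z\<rparr>)"
  using Z central by (intro group.group_comm_groupI subgroup_imp_group) auto

text \<open>Each factor is moved past \<open>g\<close> at the cost of a power of a central element, and the central elements can
  be collected at the right.\<close>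

lemma swap_power_product:
  assumes h: "\<And>i. i < d \<Longrightarrow> h i \<in> carrier G" and g: "g \<in> carrier G"
    and swap: "\<And>i. i < d \<Longrightarrow> swap_factor (h i) g \<in> Z"
  shows "power_product G h d e \<otimes> g =
     g \<otimes> power_product G h d e \<otimes> power_product G (\<lambda>i. swap_factor (h i) g) d e"
  using h swap
proof (induction d)
  case (Suc d)
  let ?P = "power_product G h d e" and ?a = "h d [^] e d" and ?k = "swap_factor (h d) g [^] e d"
  let ?K = "power_product G (\<lambda>i. swap_factor (h i) g) d e"
  have K: "?K \<in> Z" "?k \<in> Z"
    using Suc.prems(2) by (auto intro!: power_product_in_subgroup[OF Z] subgroup_int_pow_closed[OF Z])
  have c: "?P \<in> carrier G" "?a \<in> carrier G" "?k \<in> carrier G" "?K \<in> carrier G"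
    using Suc.prems K by auto
  have "?a \<otimes> g = g \<otimes> ?a \<otimes> ?k"
    using Suc.prems g by (intro int_pow_commute swap_factor central) auto
  then have "?P \<otimes> ?a \<otimes> g = (?P \<otimes> g) \<otimes> ?a \<otimes> ?k"
    using c g by (simp add: m_assoc)
  also have "\<dots> = g \<otimes> ?P \<otimes> ?K \<otimes> ?a \<otimes> ?k" using Suc by simp
  also have "\<dots> = g \<otimes> ?P \<otimes> (?K \<otimes> ?a) \<otimes> ?k" using c g by (simp add: m_assoc)
  also have "?K \<otimes> ?a = ?a \<otimes> ?K" using central K c by simp
  finally show ?case using c g by (simp add: m_assoc)
qed (use g in simp)

text \<open>Collecting the factors of a product of two power products. The correction is linear in \<open>e\<close>
  for fixed \<open>c\<close>: the power \<open>h i [^] e i\<close> has to pass the initial part of the second product.\<close>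

lemma power_product_mult_power_product:
  assumes h: "\<And>i. i < d \<Longrightarrow> h i \<in> carrier G"
    and swap: "\<And>i g. i < d \<Longrightarrow> g \<in> carrier G \<Longrightarrow> swap_factor (h i) g \<in> Z"
  shows "power_product G h d e \<otimes> power_product G h d c = power_product G h d (\<lambda>i. e i + c i) \<otimes>
     power_product G (\<lambda>i. swap_factor (h i) (power_product G h i c)) d e"
  using h swap
proof (induction d)
  case (Suc d)
  let ?g = "power_product G h d c" and ?b = "h d [^] c d"
  let ?P = "power_product G h d e" and ?a = "h d [^] e d"
  let ?k = "swap_factor (h d) ?g [^] e d"
  let ?K = "power_product G (\<lambda>i. swap_factor (h i) (power_product G h i c)) d e"
  let ?S = "power_product G h d (\<lambda>i. e i + c i)"
  have K: "?K \<in> Z" "?k \<in> Z"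
    using Suc.prems by (auto intro!: power_product_in_subgroup[OF Z] subgroup_int_pow_closed[OF Z])
  have c: "?P \<in> carrier G" "?a \<in> carrier G" "?k \<in> carrier G" "?K \<in> carrier G" "?g \<in> carrier G"
      "?b \<in> carrier G" "?S \<in> carrier G"
    using Suc.prems K by auto
  have "?a \<otimes> ?g = ?g \<otimes> ?a \<otimes> ?k"
    using Suc.prems c by (intro int_pow_commute swap_factor central) auto
  moreover have "(?P \<otimes> ?a) \<otimes> (?g \<otimes> ?b) = ?P \<otimes> (?a \<otimes> ?g) \<otimes> ?b"
    using c by (simp add: m_assoc)
  ultimately have "(?P \<otimes> ?a) \<otimes> (?g \<otimes> ?b) = (?P \<otimes> ?g) \<otimes> ?a \<otimes> ?k \<otimes> ?b"
    using c by (simp add: m_assoc)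
  also have "\<dots> = ?S \<otimes> (?K \<otimes> ?a) \<otimes> (?k \<otimes> ?b)" using Suc c by (simp add: m_assoc)
  also have "?K \<otimes> ?a = ?a \<otimes> ?K" using central K c by simp
  also have "?k \<otimes> ?b = ?b \<otimes> ?k" using central K c by simp
  also have "?S \<otimes> (?a \<otimes> ?K) \<otimes> (?b \<otimes> ?k) = ?S \<otimes> ?a \<otimes> (?K \<otimes> ?b) \<otimes> ?k" using c by (simp add: m_assoc)
  also have "?K \<otimes> ?b = ?b \<otimes> ?K" using central K c by simp
  also have "?S \<otimes> ?a \<otimes> (?b \<otimes> ?K) \<otimes> ?k = ?S \<otimes> (?a \<otimes> ?b) \<otimes> (?K \<otimes> ?k)" using c by (simp add: m_assoc)
  also have "?a \<otimes> ?b = h d [^] (e d + c d)" using Suc.prems by (simp add: int_pow_mult)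
  finally show ?case by simp
qed simp

end

section \<open>Finite index\<close>

context group
begin

text \<open>Division with remainder in each exponent: a multiple of \<open>M\<close> contributes an element of \<open>K\<close>, which by
  normality can be moved to the right end of the product.\<close>

lemma finitely_many_remainders:
  assumes K: "K \<lhd> G" and h: "\<And>i. i < d \<Longrightarrow> h i \<in> carrier G"
    and M: "(M :: int) > 0" "\<And>i. i < d \<Longrightarrow> h i [^] M \<in> K"
  shows "\<exists>F. finite F \<and> F \<subseteq> carrier G \<and> (\<forall>e. \<exists>f \<in> F. \<exists>k \<in> K. power_product G h d e = f \<otimes> k)"
  using h M(2)
proof (induction d)
  case 0
  show ?case using subgroup.one_closed[OF normal_imp_subgroup[OF K]]
    by (intro exI[of _ "{\<one>}"]) (auto intro!: bexI[of _ \<one>])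
next
  case (Suc d)
  note sK = normal_imp_subgroup[OF K]
  obtain F where F: "finite F" "F \<subseteq> carrier G"
    "\<forall>e. \<exists>f \<in> F. \<exists>k \<in> K. power_product G h d e = f \<otimes> k"
    using Suc by auto
  have hd: "h d \<in> carrier G" "h d [^] M \<in> K" using Suc.prems by auto
  let ?F = "(\<lambda>(f, s). f \<otimes> h d [^] s) ` (F \<times> {0..<M})"
  have "\<exists>f \<in> ?F. \<exists>k \<in> K. power_product G h (Suc d) e = f \<otimes> k" for e
  proof -
    obtain f k where fk: "f \<in> F" "k \<in> K" "power_product G h d e = f \<otimes> k" using F(3) by blast
    have c: "f \<in> carrier G" "k \<in> carrier G" using fk F(2) subgroup.mem_carrier[OF sK] by auto
    let ?s = "h d [^] (e d mod M)" and ?q = "(h d [^] M) [^] (e d div M)"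
    have q: "?q \<in> K" by (rule subgroup_int_pow_closed[OF sK hd(2)])
    have s: "?s \<in> carrier G" "?q \<in> carrier G" using hd by auto
    have "h d [^] e d = ?s \<otimes> ?q"
      using hd by (simp add: int_pow_pow int_pow_mult[symmetric])
    then have "power_product G h (Suc d) e = f \<otimes> k \<otimes> (?s \<otimes> ?q)" using fk(3) by simp
    \<comment> \<open>Moving \<open>k\<close> to the right past \<open>?s\<close> conjugates it, which does not lead out of \<open>K\<close>.\<close>
    also have "\<dots> = (f \<otimes> ?s) \<otimes> ((inv ?s \<otimes> k \<otimes> ?s) \<otimes> ?q)"
    proof -
      have "?s \<otimes> (inv ?s \<otimes> (k \<otimes> (?s \<otimes> ?q))) = k \<otimes> (?s \<otimes> ?q)"
        using c s by (simp add: m_assoc[symmetric])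
      then show ?thesis using c s by (simp add: m_assoc)
    qed
    finally have "power_product G h (Suc d) e = (f \<otimes> ?s) \<otimes> ((inv ?s \<otimes> k \<otimes> ?s) \<otimes> ?q)" .
    moreover have "(inv ?s \<otimes> k \<otimes> ?s) \<otimes> ?q \<in> K"
      using normal.inv_op_closed1[OF K s(1) fk(2)] q subgroup.m_closed[OF sK] by blast
    moreover have "f \<otimes> ?s \<in> ?F" using fk(1) M(1) by (force simp: image_iff)
    ultimately show ?thesis by blast
  qed
  moreover have "finite ?F" using F(1) by simp
  moreover have "?F \<subseteq> carrier G" using F(2) hd by auto
  ultimately show ?case by blast
qed

text \<open>The same coset may be represented several times in \<open>F\<close>, so one element of every coset is chosen anew.\<close>

lemma finite_transversal:
  assumes H: "subgroup H G" and F: "finite F" "F \<subseteq> carrier G"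
    "\<And>g. g \<in> carrier G \<Longrightarrow> \<exists>f \<in> F. \<exists>k \<in> H. g = f \<otimes> k"
  obtains r and m :: nat where "\<And>t. t < m \<Longrightarrow> r t \<in> carrier G"
    and "\<And>g. g \<in> carrier G \<Longrightarrow> \<exists>t<m. \<exists>k \<in> H. g = r t \<otimes> k"
    and "\<And>t t' k k'. t < m \<Longrightarrow> t' < m \<Longrightarrow> k \<in> H \<Longrightarrow> k' \<in> H \<Longrightarrow> r t \<otimes> k = r t' \<otimes> k' \<Longrightarrow> t = t'"
proof -
  define C where "C = (\<lambda>f. f <# H) ` F"
  have "finite C" using F(1) by (simp add: C_def)
  then obtain c where c: "bij_betw c {..<card C} C"
    using ex_bij_betw_nat_finite[of C] by (auto simp: atLeast0LessThan)
  define r where "r t = (SOME g. g \<in> c t)" for t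
  have self: "g \<in> g <# H" if "g \<in> carrier G" for g
    using that subgroup.one_closed[OF H] by (force simp: l_coset_def)
  have coset: "r t \<in> carrier G \<and> r t <# H = c t" if t: "t < card C" for t
  proof -
    have "c t \<in> C" using c t by (auto simp: bij_betw_def)
    then obtain f where f: "f \<in> F" "c t = f <# H" by (auto simp: C_def)
    then have "\<exists>g. g \<in> c t" using self F(2) by blast
    then have "r t \<in> f <# H" using f(2) unfolding r_def by (metis someI_ex)
    moreover have "f \<in> carrier G" using f F(2) by blast
    ultimately show ?thesis
      using l_repr_independence[OF _ _ H] l_coset_subset_G[OF subgroup.subset[OF H]] f(2) by blast
  qed
  show thesis
  proof (rule that[of "card C" r])
    show "r t \<in> carrier G" if "t < card C" for t using coset[OF that] by simp
    show "\<exists>t<card C. \<exists>k \<in> H. g = r t \<otimes> k" if g: "g \<in> carrier G" for g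
    proof -
      obtain f k where "f \<in> F" "k \<in> H" "g = f \<otimes> k" using F(3) g by blast
      then have "g \<in> f <# H" "f <# H \<in> C" by (auto simp: l_coset_def C_def)
      then obtain t where "t < card C" "c t = f <# H"
        using c unfolding bij_betw_def by (metis imageE lessThan_iff)
      moreover from this have "g \<in> r t <# H" using coset \<open>g \<in> f <# H\<close> by simp
      ultimately show ?thesis by (auto simp: l_coset_def)
    qed
    show "t = t'" if t: "t < card C" "t' < card C" and k: "k \<in> H" "k' \<in> H"
      and eq: "r t \<otimes> k = r t' \<otimes> k'" for t t' k k'
    proof -
      have "r t \<otimes> k \<in> r t <# H" "r t \<otimes> k \<in> r t' <# H"
        using k unfolding eq by (auto simp: l_coset_def eq[symmetric]) (auto simp: eq)
      then have "r t <# H = r t' <# H"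
        using l_repr_independence[OF _ _ H] coset t by metis
      then show ?thesis using coset t c by (auto simp: bij_betw_def inj_on_def)
    qed
  qed
qed

end

section \<open>Groups with a central basis\<close>

context central_subgroup
begin

lemma swap_factor_central: "z \<in> Z \<Longrightarrow> g \<in> carrier G \<Longrightarrow> swap_factor z g = \<one>"
  using central by (simp add: swap_factor_def)

end

text \<open>The group-theoretic situation behind an affine normal form: the last \<open>q\<close> of the elements \<open>h\<close> are central and their
  power products fill \<open>Z\<close>, and modulo \<open>Z\<close> the first \<open>r\<close> elements are central.\<close>

locale central_basis = central_subgroup G Z for G (structure) and Z +
  fixes r q :: nat and h :: "nat \<Rightarrow> 'a"
  assumes h: "i < r + q \<Longrightarrow> h i \<in> carrier G"
    and ZH: "Z = range (power_product G (\<lambda>j. h (r + j)) q)"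
    and swap: "i < r \<Longrightarrow> g \<in> carrier G \<Longrightarrow> swap_factor (h i) g \<in> Z"
begin

abbreviation "d \<equiv> r + q"

definition z :: "nat \<Rightarrow> 'a" where
  "z j = h (r + j)"

abbreviation E :: "(nat \<Rightarrow> int) \<Rightarrow> 'a" where
  "E \<equiv> power_product G h d"

lemma Z_eq: "Z = range (power_product G z q)"
  unfolding ZH z_def[abs_def] ..

lemma zG: "j < q \<Longrightarrow> z j \<in> carrier G"
  using h by (simp add: z_def)

lemma zZ: "j < q \<Longrightarrow> z j \<in> Z"
proof -
  assume "j < q"
  then have "power_product G z q (\<lambda>i. if i = j then 1 else 0) = z j"
    using zG by (simp add: power_product_unit_vector)
  then show ?thesis unfolding Z_eq by (metis rangeI)
qed

lemma power_product_Z: "power_product (G\<lparr>carrier := Z\<rparr>) z q f = power_product G z q f"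
  using Z zZ by (rule power_product_restrict)

lemma E_closed [simp]: "E e \<in> carrier G"
  using h by auto

lemma swap_factor_in_Z:
  assumes "i < d" "g \<in> carrier G"
  shows "swap_factor (h i) g \<in> Z"
proof (cases "i < r")
  case False
  then have "h i = z (i - r)" "i - r < q" using assms by (auto simp: z_def)
  then show ?thesis using swap_factor_central zZ assms subgroup.one_closed[OF Z] by simp
qed (use swap assms in auto)

lemma E_mult_Z: "E e \<otimes> power_product G z q f = E (\<lambda>k. if k < r then e k else e k + f (k - r))"
proof -
  interpret Zg: comm_group "G\<lparr>carrier := Z\<rparr>" by (rule comm_group_Z)
  have zz: "power_product G z q e' \<otimes> power_product G z q f = power_product G z q (\<lambda>i. e' i + f i)" for e'
    using Zg.power_product_mult[of q z e' f] zZ unfolding power_product_Z by simp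
  have c: "power_product G h r e' \<in> carrier G" "power_product G z q e' \<in> carrier G" for e'
    using h zG by auto
  have split: "E e = power_product G h r e \<otimes> power_product G z q (\<lambda>j. e (r + j))" for e
    unfolding z_def[abs_def] using h by (rule power_product_append)
  have "E e \<otimes> power_product G z q f =
      power_product G h r e \<otimes> power_product G z q (\<lambda>j. e (r + j) + f j)"
    unfolding split using c zz[of "\<lambda>j. e (r + j)"] by (simp add: m_assoc)
  also have "power_product G h r e = power_product G h r (\<lambda>k. if k < r then e k else e k + f (k - r))"
    by (rule power_product_cong) simp
  finally show ?thesis unfolding split[of "\<lambda>k. if k < r then e k else e k + f (k - r)"] by simp
qed

lemma E_mult_in_range:
  assumes "k \<in> Z"
  shows "E e \<otimes> k \<in> range E"
  using assms E_mult_Z[of e] unfolding Z_eq by auto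

lemma E_mult: "E e \<otimes> E c = E (\<lambda>i. e i + c i) \<otimes>
    power_product G (\<lambda>i. swap_factor (h i) (power_product G h i c)) d e"
  using h swap_factor_in_Z by (rule power_product_mult_power_product)

lemma swap_E: "g \<in> carrier G \<Longrightarrow>
    E e \<otimes> g = g \<otimes> E e \<otimes> power_product G (\<lambda>i. swap_factor (h i) g) d e"
  using h swap_factor_in_Z by (intro swap_power_product) auto

text \<open>Collection computes products of members, and the product of \<open>E e\<close> with \<open>E (\<lambda>i. - e i)\<close>, up to
  a factor in \<open>Z\<close>, and \<open>range E\<close> absorbs such factors.\<close>

lemma subgroup_E: "subgroup (range E) G"
proof (rule subgroupI)
  have factor_Z: "power_product G (\<lambda>i. swap_factor (h i) (power_product G h i c)) d e \<in> Z" for e c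
    using h by (intro power_product_in_subgroup[OF Z] subgroup_int_pow_closed[OF Z] swap_factor_in_Z) auto
  show "a \<otimes> b \<in> range E" if "a \<in> range E" "b \<in> range E" for a b
    using that E_mult factor_Z E_mult_in_range by auto
  show "inv a \<in> range E" if aE: "a \<in> range E" for a
  proof -
    obtain e where a: "a = E e" using aE by blast
    define k where "k = E e \<otimes> E (\<lambda>i. - e i)"
    have k: "k \<in> Z"
      unfolding k_def E_mult using factor_Z by simp
    have "a \<otimes> (E (\<lambda>i. - e i) \<otimes> inv k) = \<one>"
      using k by (simp add: a m_assoc[symmetric] k_def[symmetric])
    then have "inv a = E (\<lambda>i. - e i) \<otimes> inv k"
      using k a by (intro inv_equality) (auto intro: inv_comm)
    then show ?thesis using E_mult_in_range subgroup.m_inv_closed[OF Z k] by simp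
  qed
qed auto

text \<open>Conjugation changes \<open>E e\<close> only by a factor in \<open>Z\<close>.\<close>

lemma normal_E: "range E \<lhd> G"
  unfolding normal_inv_iff
proof (intro conjI ballI subgroup_E)
  fix g k assume g: "g \<in> carrier G" and "k \<in> range E"
  then obtain e where k: "k = E e" by blast
  define u where "u = power_product G (\<lambda>i. swap_factor (h i) (inv g)) d e"
  have u: "u \<in> Z" unfolding u_def
    using g by (intro power_product_in_subgroup[OF Z] subgroup_int_pow_closed[OF Z] swap_factor_in_Z) auto
  have "E e \<otimes> inv g = inv g \<otimes> E e \<otimes> u" using swap_E[of "inv g" e] g by (simp add: u_def)
  then have "g \<otimes> k \<otimes> inv g = g \<otimes> (inv g \<otimes> E e \<otimes> u)" using g by (simp add: k m_assoc)
  also have "\<dots> = E e \<otimes> u" using g u by (simp add: m_assoc[symmetric])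
  finally show "g \<otimes> k \<otimes> inv g \<in> range E" using E_mult_in_range[OF u] by simp
qed

lemma linear_exponents:
  assumes "\<And>i. i < d \<Longrightarrow> \<kappa> i \<in> Z"
  shows "\<exists>b. \<forall>e. power_product G \<kappa> d e = power_product G z q (\<lambda>j. \<Sum>i<d. b i j * e i)"
proof -
  interpret Zg: comm_group "G\<lparr>carrier := Z\<rparr>" by (rule comm_group_Z)
  have "\<forall>i. \<exists>b. i < d \<longrightarrow> \<kappa> i = power_product G z q b" using assms unfolding Z_eq by blast
  then obtain b where b: "\<And>i. i < d \<Longrightarrow> \<kappa> i = power_product G z q (b i)" by metis
  have "power_product G \<kappa> d e = power_product G z q (\<lambda>j. \<Sum>i<d. b i j * e i)" for e
    using Zg.power_product_substitute[of q z d \<kappa> b e] zZ b power_product_restrict[OF Z assms]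
    by (simp add: power_product_Z)
  then show ?thesis by blast
qed

text \<open>Let \<open>g\<close> multiply \<open>\<rho> t \<otimes> E e\<close> from the right, where \<open>\<rho> t \<otimes> g = \<rho> t' \<otimes> E c\<close>. Moving \<open>E e\<close> to the
  right past \<open>g \<otimes> inv (E c)\<close> costs a central factor that is linear in \<open>e\<close> and leaves \<open>\<rho> t' \<otimes> (E e \<otimes> E c)\<close>;
  collecting the last two factors gives the exponents \<open>e + c\<close> and a second central factor that
  is linear in \<open>e\<close>. So the new exponents are affine functions of the old ones.\<close>

theorem P_group_of_central_basis:
  assumes unique: "\<And>e e'. E e = E e' \<Longrightarrow> \<forall>i<d. e i = e' i"
    and F: "finite F" "F \<subseteq> carrier G" "\<And>g. g \<in> carrier G \<Longrightarrow> \<exists>f \<in> F. \<exists>k \<in> range E. g = f \<otimes> k"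
  shows "P_group G"
proof -
  obtain \<rho> and m :: nat where \<rho>: "\<And>t. t < m \<Longrightarrow> \<rho> t \<in> carrier G"
    and surj: "\<And>g. g \<in> carrier G \<Longrightarrow> \<exists>t<m. \<exists>k \<in> range E. g = \<rho> t \<otimes> k"
    and inj: "\<And>t t' k k'. t < m \<Longrightarrow> t' < m \<Longrightarrow> k \<in> range E \<Longrightarrow> k' \<in> range E \<Longrightarrow>
        \<rho> t \<otimes> k = \<rho> t' \<otimes> k' \<Longrightarrow> t = t'"
    by (rule finite_transversal[OF subgroup_E F]) (assumption, blast)
  show ?thesis
  proof (rule P_group_if_affine_normal_form[of d h m \<rho>])
    show "\<exists>t<m. \<exists>e. g = \<rho> t \<otimes> power_product G h d e" if "g \<in> carrier G" for g
      using surj[OF that]  by blast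
    show "t = t' \<and> (\<forall>i<d. e i = e' i)" if t: "t < m" "t' < m"
      and eq: "\<rho> t \<otimes> power_product G h d e = \<rho> t' \<otimes> power_product G h d e'" for t t' e e'
    proof -
      have "t = t'" using inj[OF t] eq  by blast
      then have "E e = E e'" using eq \<rho>[OF t(1)] E_closed  by simp
      then show ?thesis using unique \<open>t = t'\<close>  by blast
    qed
    show "\<exists>t'<m. \<exists>c M. \<forall>e. \<rho> t \<otimes> power_product G h d e \<otimes> g =
        \<rho> t' \<otimes> power_product G h d (\<lambda>k. (\<Sum>i<d. M k i * e i) + c k)"
      if g: "g \<in> carrier G" and t: "t < m" for g t
    proof -
      obtain t' c where t': "t' < m" and c: "\<rho> t \<otimes> g = \<rho> t' \<otimes> E c"
        using surj[of "\<rho> t \<otimes> g"] g \<rho>[OF t] by blast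
      define g' where "g' = g \<otimes> inv (E c)"
      have g': "g' \<in> carrier G" "g = g' \<otimes> E c" "\<rho> t \<otimes> g' = \<rho> t'"
        using g c \<rho>[OF t] \<rho>[OF t']
        by (simp_all add: g'_def m_assoc m_assoc[of "\<rho> t" g, symmetric])
      have "\<exists>b. \<forall>e. power_product G (\<lambda>i. swap_factor (h i) g') d e =
          power_product G z q (\<lambda>j. \<Sum>i<d. b i j * e i)"
        using swap_factor_in_Z g' by (intro linear_exponents) auto
      then obtain b1 where b1: "\<And>e. power_product G (\<lambda>i. swap_factor (h i) g') d e =
          power_product G z q (\<lambda>j. \<Sum>i<d. b1 i j * e i)" by blast
      have "\<exists>b. \<forall>e. power_product G (\<lambda>i. swap_factor (h i) (power_product G h i c)) d e =
          power_product G z q (\<lambda>j. \<Sum>i<d. b i j * e i)"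
        using swap_factor_in_Z h by (intro linear_exponents) auto
      then obtain b2 where b2: "\<And>e. power_product G (\<lambda>i. swap_factor (h i) (power_product G h i c)) d e =
          power_product G z q (\<lambda>j. \<Sum>i<d. b2 i j * e i)" by blast
      \<comment> \<open>The identity matrix comes from \<open>e + c\<close>; only the exponents of central elements receive corrections.\<close>
      define M where "M k i = of_bool (i = k) + (if k < r then 0 else b1 i (k - r) + b2 i (k - r))" for k i
      have "\<rho> t \<otimes> E e \<otimes> g = \<rho> t' \<otimes> E (\<lambda>k. (\<Sum>i<d. M k i * e i) + c k)" for e
      proof -
        let ?K1 = "power_product G z q (\<lambda>j. \<Sum>i<d. b1 i j * e i)"
        let ?K2 = "power_product G z q (\<lambda>j. \<Sum>i<d. b2 i j * e i)"
        have K: "?K1 \<in> Z" "?K2 \<in> Z" unfolding Z_eq by auto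
        have "E e \<otimes> g' = g' \<otimes> E e \<otimes> ?K1"
          using swap_E[OF g'(1), of e] unfolding b1 .
        moreover have "E e \<otimes> E c = E (\<lambda>i. e i + c i) \<otimes> ?K2" unfolding E_mult b2 ..
        moreover have "?K1 \<otimes> E c = E c \<otimes> ?K1" using K central by simp
        moreover have "\<rho> t \<otimes> E e \<otimes> (g' \<otimes> E c) = \<rho> t \<otimes> (E e \<otimes> g') \<otimes> E c"
          using g'(1) \<rho>[OF t] by (simp add: m_assoc)
        moreover have "\<rho> t \<otimes> (g' \<otimes> E e \<otimes> ?K1) \<otimes> E c = \<rho> t \<otimes> g' \<otimes> E e \<otimes> (?K1 \<otimes> E c)"
          using g'(1) \<rho>[OF t] K by (simp add: m_assoc)
        moreover have "\<rho> t' \<otimes> E e \<otimes> (E c \<otimes> ?K1) = \<rho> t' \<otimes> ((E e \<otimes> E c) \<otimes> ?K1)"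
          using \<rho>[OF t'] K by (simp add: m_assoc)
        ultimately have "\<rho> t \<otimes> E e \<otimes> g = \<rho> t' \<otimes> (E (\<lambda>i. e i + c i) \<otimes> ?K2 \<otimes> ?K1)"
          using g' by simp
        also have "E (\<lambda>i. e i + c i) \<otimes> ?K2 \<otimes> ?K1 = E (\<lambda>k. (\<Sum>i<d. M k i * e i) + c k)"
          unfolding E_mult_Z
        proof (intro power_product_cong allI impI)
          fix k assume "k < d"
          then have "(\<Sum>i<d. of_bool (i = k) * e i) = e k"
            by (simp add: of_bool_def if_distrib[where f = "\<lambda>x. x * _"] cong: if_cong)
          then show "(if k < r then if k < r then e k + c k else e k + c k + (\<Sum>i<d. b2 i (k - r) * e i)
              else (if k < r then e k + c k else e k + c k + (\<Sum>i<d. b2 i (k - r) * e i)) +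
                (\<Sum>i<d. b1 i (k - r) * e i)) = (\<Sum>i<d. M k i * e i) + c k"
            by (simp add: M_def distrib_right sum.distrib)
        qed
        finally show ?thesis .
      qed
      then show ?thesis using t'  by blast
    qed
  qed (use h \<rho> in auto)
qed

end

section \<open>Groups with central commutators\<close>

context group
begin

definition commutator :: "'a \<Rightarrow> 'a \<Rightarrow> 'a" where
  "commutator a b = a \<otimes> b \<otimes> inv a \<otimes> inv b"

lemma commutator_closed [simp]:
  "a \<in> carrier G \<Longrightarrow> b \<in> carrier G \<Longrightarrow> commutator a b \<in> carrier G"
  by (simp add: commutator_def)

lemma commutator_swap: "a \<in> carrier G \<Longrightarrow> b \<in> carrier G \<Longrightarrow> a \<otimes> b = commutator a b \<otimes> (b \<otimes> a)"
  by (simp add: commutator_def m_assoc) (simp add: m_assoc[symmetric])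

lemma inv_commutator: "a \<in> carrier G \<Longrightarrow> b \<in> carrier G \<Longrightarrow> inv (commutator a b) = commutator b a"
  by (simp add: commutator_def inv_mult_group m_assoc)

lemma commutator_mult_left:
  assumes "a \<in> carrier G" "b \<in> carrier G" "c \<in> carrier G"
    and "a \<otimes> commutator b c = commutator b c \<otimes> a"
  shows "commutator (a \<otimes> b) c = commutator b c \<otimes> commutator a c"
proof -
  have cancel: "b \<otimes> (inv b \<otimes> u) = u" if "u \<in> carrier G" for u
    using assms(2) that by (simp add: m_assoc[symmetric])
  have "commutator (a \<otimes> b) c = (a \<otimes> (commutator b c \<otimes> (c \<otimes> b))) \<otimes> (inv b \<otimes> inv a \<otimes> inv c)"
    using assms(1-3) unfolding commutator_swap[OF assms(2,3), symmetric]
    by (simp add: commutator_def inv_mult_group m_assoc cancel)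
  also have "\<dots> = (a \<otimes> commutator b c) \<otimes> (c \<otimes> (b \<otimes> inv b) \<otimes> inv a \<otimes> inv c)"
    using assms(1-3) by (simp add: m_assoc cancel)
  also have "\<dots> = (commutator b c \<otimes> a) \<otimes> (c \<otimes> inv a \<otimes> inv c)"
    using assms by simp
  also have "\<dots> = commutator b c \<otimes> commutator a c"
    using assms(1-3) commutator_closed[of b c] by (simp add: commutator_def[of a] m_assoc)
  finally show ?thesis .
qed

text \<open>As commutators are central, they are multiplicative in each argument, so those of the generators
  control all others. The argument is applied to the left variable twice, with an exchange of the two
  variables in between.\<close>

lemma commutators_in_subgroup:
  assumes Z: "subgroup Z G" and X: "X \<subseteq> carrier G" "generate G X = carrier G"
    and central: "\<And>a b c. a \<in> carrier G \<Longrightarrow> b \<in> carrier G \<Longrightarrow> c \<in> carrier G \<Longrightarrow>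
      c \<otimes> commutator a b = commutator a b \<otimes> c"
    and gens: "\<And>x y. x \<in> X \<Longrightarrow> y \<in> X \<Longrightarrow> commutator x y \<in> Z"
    and ab: "a \<in> carrier G" "b \<in> carrier G"
  shows "commutator a b \<in> Z"
proof -
  have left: "commutator a y \<in> Z"
    if y: "y \<in> carrier G" and base: "\<And>x. x \<in> X \<Longrightarrow> commutator x y \<in> Z" and a: "a \<in> generate G X" for a y
    using a
  proof induction
    case one
    then show ?case using y subgroup.one_closed[OF Z] by (simp add: commutator_def)
  next
    case (incl h)
    then show ?case by (rule base)
  next
    case (inv h)
    have h: "h \<in> carrier G" using inv X by blast
    have "commutator (h \<otimes> inv h) y = commutator (inv h) y \<otimes> commutator h y"
      using h y central by (intro commutator_mult_left) auto
    moreover have "commutator (h \<otimes> inv h) y = \<one>" using h y by (simp add: commutator_def)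
    ultimately have "commutator (inv h) y = inv (commutator h y)"
      using h y by (intro inv_equality[symmetric]) auto
    then show ?case using subgroup.m_inv_closed[OF Z base[OF inv]] by simp
  next
    case (eng a b)
    have "a \<in> carrier G" "b \<in> carrier G" using eng X by auto
    then have "commutator (a \<otimes> b) y = commutator b y \<otimes> commutator a y"
      using y central by (intro commutator_mult_left) auto
    then show ?case using eng subgroup.m_closed[OF Z] by simp
  qed
  have "commutator b x \<in> Z" if "x \<in> X" for x
    using left[of x b] gens that X ab by auto
  then have "commutator x b \<in> Z" if "x \<in> X" for x
    using that X ab subgroup.m_inv_closed[OF Z, of "commutator b x"] by (auto simp: inv_commutator)
  then show ?thesis using left[of b a] ab X(2) by simp
qed

lemma normal_if_commutators:
  assumes K: "subgroup K G" and c: "\<And>a b. a \<in> carrier G \<Longrightarrow> b \<in> carrier G \<Longrightarrow> commutator a b \<in> K"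
  shows "K \<lhd> G"
  unfolding normal_inv_iff
proof (intro conjI ballI K)
  fix x h assume x: "x \<in> carrier G" and h: "h \<in> K"
  have hc: "h \<in> carrier G" using subgroup.mem_carrier[OF K h] .
  have "x \<otimes> h \<otimes> inv x = commutator x h \<otimes> h"
    using x hc by (simp add: commutator_def m_assoc)
  then show "x \<otimes> h \<otimes> inv x \<in> K" using subgroup.m_closed[OF K c[OF x hc] h] by simp
qed

lemma finite_cover_trans:
  assumes F: "finite F" "F \<subseteq> carrier G" "\<And>s. s \<in> S \<Longrightarrow> \<exists>f \<in> F. \<exists>k \<in> K. s = f \<otimes> k"
    and F': "finite F'" "F' \<subseteq> carrier G" "\<And>s. s \<in> K \<Longrightarrow> \<exists>f \<in> F'. \<exists>k \<in> H. s = f \<otimes> k"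
    and H: "H \<subseteq> carrier G"
  shows "\<exists>F. finite F \<and> F \<subseteq> carrier G \<and> (\<forall>s \<in> S. \<exists>f \<in> F. \<exists>k \<in> H. s = f \<otimes> k)"
proof (intro exI[of _ "(\<lambda>(f, f'). f \<otimes> f') ` (F \<times> F')"] conjI ballI)
  fix s assume "s \<in> S"
  then obtain f k where f: "f \<in> F" "k \<in> K" "s = f \<otimes> k" using F(3) by blast
  then obtain f' k' where f': "f' \<in> F'" "k' \<in> H" "k = f' \<otimes> k'" using F'(3) by blast
  have "s = (f \<otimes> f') \<otimes> k'"
    using f f' F(2) F'(2) H by (simp add: m_assoc subset_iff)
  then show "\<exists>f \<in> (\<lambda>(f, f'). f \<otimes> f') ` (F \<times> F'). \<exists>k \<in> H. s = f \<otimes> k"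
    using f(1) f'(1,2) by blast
qed (use F(1,2) F'(1,2) in auto)

text \<open>Let \<open>N\<close> be generated by the commutators of the generators; it is central, finitely generated
  and contains all commutators. Choose a maximal family \<open>y\<close> of generators that is independent modulo \<open>N\<close>, and
  a maximal independent family \<open>z\<close> of generators of \<open>N\<close>. Then all powers with exponent \<open>M2\<close> of elements
  of \<open>N\<close> lie in the subgroup \<open>Z\<close> generated by \<open>z\<close>. The
  elements \<open>y\<close> may have commutators outside \<open>Z\<close>, but their powers \<open>y [^] M2\<close> do not. These powers
  together with \<open>z\<close> are a basis as required. They have unique exponents, by independence in the quotient and
  then in \<open>N\<close>, and they generate a subgroup of finite index: powers of all generators of the group lie in the
  subgroup \<open>H1\<close> generated by \<open>y\<close> and \<open>N\<close>, and powers of \<open>y\<close> and of all generators of \<open>N\<close> lie in the smaller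
  subgroup.\<close>

theorem P_group_of_central_commutators:
  assumes X: "finite X" "X \<subseteq> carrier G" "generate G X = carrier G"
    and central: "\<And>a b c. a \<in> carrier G \<Longrightarrow> b \<in> carrier G \<Longrightarrow> c \<in> carrier G \<Longrightarrow>
      c \<otimes> commutator a b = commutator a b \<otimes> c"
  shows "P_group G"
proof -
  define C where "C = (\<lambda>(x, y). commutator x y) ` (X \<times> X)"
  have finC: "finite C" using X(1) by (simp add: C_def)
  have CG: "C \<subseteq> carrier G" using subsetD[OF X(2)] by (auto simp: C_def)
  define N where "N = generate G C"
  have N: "subgroup N G" unfolding N_def by (rule generate_is_subgroup[OF CG])
  note N_carrier = subgroup.mem_carrier[OF N]
  have comm_N: "commutator a b \<in> N" if "a \<in> carrier G" "b \<in> carrier G" for a b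
    using N X(2,3) central
  proof (rule commutators_in_subgroup)
    show "commutator x y \<in> N" if "x \<in> X" "y \<in> X" for x y
      unfolding N_def using that by (intro generate.incl) (auto simp: C_def)
  qed (use that in auto)
  have N_central: "z \<otimes> g = g \<otimes> z" if z: "z \<in> N" and g: "g \<in> carrier G" for z g
    using z unfolding N_def
  proof induction
    case (incl h)
    then obtain x y where "x \<in> X" "y \<in> X" "h = commutator x y" by (auto simp: C_def)
    then show ?case using central[of x y g] X(2) g by (simp add: subset_iff)
  next
    case (inv h)
    then obtain x y where xy: "x \<in> carrier G" "y \<in> carrier G" "h = commutator x y"
      using X(2) by (auto simp: C_def)
    then show ?case using central[of y x g] g by (simp add: inv_commutator)
  next
    case (eng a b)
    have "a \<in> carrier G" "b \<in> carrier G" using eng(1,2) generate_in_carrier[OF CG] by auto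
    then show ?case using eng(3,4) g by (simp add: m_assoc) (simp add: m_assoc[symmetric])
  qed (use g in simp)
  have normN: "N \<lhd> G" using N comm_N by (rule normal_if_commutators)

  define Q where "Q = G Mod N"
  define \<pi> where "\<pi> = (\<lambda>g. N #> g)"
  have Q: "comm_group Q"
  proof (rule group.group_comm_groupI)
    show "group Q" unfolding Q_def by (rule normal.factorgroup_is_group[OF normN])
    fix a b assume "a \<in> carrier Q" "b \<in> carrier Q"
    then obtain x y where xy: "x \<in> carrier G" "y \<in> carrier G" "a = N #> x" "b = N #> y"
      by (auto simp: Q_def FactGroup_def RCOSETS_def)
    have "N #> (x \<otimes> y) = N #> (y \<otimes> x)"
    proof (rule repr_independence[symmetric])
      show "x \<otimes> y \<in> N #> (y \<otimes> x)"
        using commutator_swap[of x y] comm_N[of x y] xy by (auto simp: r_coset_def)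
    qed (use xy N in auto)
    then show "a \<otimes>\<^bsub>Q\<^esub> b = b \<otimes>\<^bsub>Q\<^esub> a"
      using xy normal.rcos_sum[OF normN] by (simp add: Q_def FactGroup_def)
  qed
  interpret Q: comm_group Q by (rule Q)
  have hom: "group_hom G Q \<pi>"
    unfolding group_hom_def group_hom_axioms_def Q_def \<pi>_def
    using normal.r_coset_hom_Mod[OF normN] normal.factorgroup_is_group[OF normN] by simp
  interpret \<pi>: group_hom G Q \<pi> by (rule hom)
  have carrierQ: "carrier Q = \<pi> ` carrier G"
    by (auto simp: Q_def FactGroup_def RCOSETS_def \<pi>_def)
  have \<pi>_eq: "\<exists>k \<in> N. a = b \<otimes> k" if "\<pi> a = \<pi> b" "a \<in> carrier G" "b \<in> carrier G" for a b
  proof -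
    have "a \<in> N #> b" using rcos_self[OF that(2) N] that(1) by (simp add: \<pi>_def)
    then obtain k where "k \<in> N" "a = k \<otimes> b" by (auto simp: r_coset_def)
    then show ?thesis using N_central[of k b] that(3) by auto
  qed
  have \<pi>_N: "\<pi> k = \<one>\<^bsub>Q\<^esub>" if "k \<in> N" for k
    using coset_join2[OF N_carrier[OF that] N that] by (simp add: \<pi>_def Q_def FactGroup_def)

  interpret N: central_subgroup G N
    by (intro central_subgroup.intro central_subgroup_axioms.intro is_group N N_central)
  interpret Ng: comm_group "G\<lparr>carrier := N\<rparr>" by (rule N.comm_group_Z)

  obtain n and x :: "nat \<Rightarrow> 'a" where x: "X = x ` {..<n}"
    using finite_imp_nat_seg_image_inj_on[OF X(1)] by (auto simp: lessThan_def)
  obtain p and w :: "nat \<Rightarrow> 'a" where w: "C = w ` {..<p}"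
    using finite_imp_nat_seg_image_inj_on[OF finC] by (auto simp: lessThan_def)
  have xG: "x i \<in> carrier G" if "i < n" for i using X(2) x that by auto
  have wN: "w i \<in> N" if "i < p" for i
    using that w unfolding N_def by (intro generate.incl) auto

  obtain r s and M1 :: int where s: "\<And>i. i < r \<Longrightarrow> s i < n"
    and indQ: "\<And>e. power_product Q (\<lambda>i. \<pi> (x (s i))) r e = \<one>\<^bsub>Q\<^esub> \<Longrightarrow> \<forall>i<r. e i = 0"
    and M1: "M1 > 0" "\<And>i. i < n \<Longrightarrow> \<pi> (x i) [^]\<^bsub>Q\<^esub> M1 \<in> range (power_product Q (\<lambda>i. \<pi> (x (s i))) r)"
  proof (rule Q.maximal_independent_subfamily[of n "\<lambda>i. \<pi> (x i)"])
    show "\<pi> (x i) \<in> carrier Q" if "i < n" for i using xG[OF that] by simp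
  qed (rule that)
  obtain q s' and M2 :: int where s': "\<And>i. i < q \<Longrightarrow> s' i < p"
    and indN: "\<And>e. power_product (G\<lparr>carrier := N\<rparr>) (\<lambda>i. w (s' i)) q e = \<one>\<^bsub>G\<lparr>carrier := N\<rparr>\<^esub> \<Longrightarrow> \<forall>i<q. e i = 0"
    and M2: "M2 > 0" "\<And>i. i < p \<Longrightarrow> w i [^]\<^bsub>G\<lparr>carrier := N\<rparr>\<^esub> M2 \<in>
      range (power_product (G\<lparr>carrier := N\<rparr>) (\<lambda>i. w (s' i)) q)"
  proof (rule Ng.maximal_independent_subfamily[of p w])
    show "w i \<in> carrier (G\<lparr>carrier := N\<rparr>)" if "i < p" for i using wN[OF that] by simp
  qed (rule that)
  define y where "y = (\<lambda>i. x (s i))"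
  define z where "z = (\<lambda>i. w (s' i))"
  have yG: "y i \<in> carrier G" if "i < r" for i using s xG that by (simp add: y_def)
  have zN: "z i \<in> N" if "i < q" for i using s' wN that by (simp add: z_def)
  have ppN: "power_product (G\<lparr>carrier := N\<rparr>) z q e = power_product G z q e" for e
    using N zN by (rule power_product_restrict)
  define Z where "Z = range (power_product G z q)"
  have ZN: "subgroup Z (G\<lparr>carrier := N\<rparr>)"
    using Ng.subgroup_power_products[of q z] zN unfolding Z_def ppN[abs_def] by simp
  have Z: "subgroup Z G" using incl_subgroup[OF N ZN] .
  have Z_sub: "Z \<subseteq> N" using subgroup.subset[OF ZN] by simp
  have powN: "k [^]\<^bsub>G\<lparr>carrier := N\<rparr>\<^esub> (e :: int) = k [^] e" if "k \<in> N" for k e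
    using int_pow_consistent[OF N that] by simp
  have gen_N: "\<exists>e. k = power_product G w p e" if "k \<in> N" for k
  proof -
    have "k \<in> generate (G\<lparr>carrier := N\<rparr>) (w ` {..<p})"
      using that generate_consistent[OF _ N, of C] wN unfolding w[symmetric] N_def[symmetric]
      by (simp add: w image_subset_iff N_def)
    then obtain e where "k = power_product (G\<lparr>carrier := N\<rparr>) w p e"
      using Ng.generate_power_products[of p w] wN by auto
    then show ?thesis using power_product_restrict[OF N, of p w e] wN by auto
  qed
  have wZ: "w i [^] M2 \<in> Z" if "i < p" for i
    using M2(2)[OF that] powN[OF wN[OF that]] ppN unfolding z_def[symmetric] Z_def by auto
  have NZ: "k [^] M2 \<in> Z" if k: "k \<in> N" for k
  proof -
    obtain e where e: "k = power_product G w p e" using gen_N[OF k] by blast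
    have "power_product (G\<lparr>carrier := N\<rparr>) w p e [^]\<^bsub>G\<lparr>carrier := N\<rparr>\<^esub> M2 \<in> Z"
      using wN wZ powN by (intro Ng.power_product_pow_in_subgroup[OF ZN]) auto
    then show ?thesis using powN[OF k] e power_product_restrict[OF N, of p w e] wN by simp
  qed

  define h where "h i = (if i < r then y i [^] M2 else z (i - r))" for i
  have hG: "h i \<in> carrier G" if "i < r + q" for i
    using that yG zN N_carrier by (auto simp: h_def)
  have hz: "(\<lambda>j. h (r + j)) = z" by (auto simp: h_def)
  have swap: "swap_factor (h i) g \<in> Z" if i: "i < r" and g: "g \<in> carrier G" for i g
  proof -
    have y: "y i \<in> carrier G" using yG i .
    have k: "swap_factor (y i) g \<in> N"
    proof -
      have "swap_factor (y i) g = commutator (inv y i) (inv g)"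
        using y g by (simp add: swap_factor_def commutator_def inv_mult_group m_assoc)
      then show ?thesis using comm_N y g by simp
    qed
    have "h i \<otimes> g = g \<otimes> h i \<otimes> swap_factor (y i) g [^] M2"
      using int_pow_commute[OF y g N_carrier[OF k] N_central[OF k y] swap_factor[OF y g]] i
      by (simp add: h_def)
    then have "swap_factor (h i) g = swap_factor (y i) g [^] M2"
      using hG[of i] i g N_carrier[OF k] by (intro swap_factor_eqI) auto
    then show ?thesis using NZ[OF k] by simp
  qed
  interpret basis: central_basis G Z r q h
  proof (intro central_basis.intro central_subgroup.intro central_subgroup_axioms.intro
      central_basis_axioms.intro is_group Z hG swap)
    show "k \<otimes> g = g \<otimes> k" if "k \<in> Z" "g \<in> carrier G" for k g
      using that Z_sub N_central by blast
    show "Z = range (power_product G (\<lambda>j. h (r + j)) q)" unfolding hz Z_def ..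
  qed
  have split: "power_product G h (r + q) e = power_product G (\<lambda>i. y i [^] M2) r e \<otimes>
      power_product G z q (\<lambda>j. e (r + j))" for e
  proof -
    have "power_product G h r e = power_product G (\<lambda>i. y i [^] M2) r e"
      by (rule power_product_cong_base) (simp add: h_def)
    then show ?thesis using power_product_append[of r q h e] hG hz by simp
  qed
  have \<pi>y: "\<pi> (power_product G y r e) = power_product Q (\<lambda>i. \<pi> (x (s i))) r e" for e
    using power_product_hom[OF hom, of r y e] yG by (simp add: y_def)
  have zG: "z i \<in> carrier G" if "i < q" for i using zN that N_carrier by blast
  have zpp: "power_product G z q e \<in> N" for e using Z_sub unfolding Z_def by auto
  have unique: "\<forall>i<r + q. e i = e' i"
    if eq: "power_product G h (r + q) e = power_product G h (r + q) e'" for e e'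
  proof -
    have "power_product Q (\<lambda>i. \<pi> (x (s i))) r e \<in> carrier Q" for e
      using s xG by (intro Q.power_product_closed) auto
    then have "\<pi> (power_product G h (r + q) e) = power_product Q (\<lambda>i. \<pi> (x (s i))) r (\<lambda>i. M2 * e i)" for e
      unfolding split using \<pi>y[of "\<lambda>i. M2 * e i"] power_product_pow[of r y M2 e] yG zG \<pi>_N[OF zpp]
      by simp
    then have "power_product Q (\<lambda>i. \<pi> (x (s i))) r (\<lambda>i. M2 * e i) =
        power_product Q (\<lambda>i. \<pi> (x (s i))) r (\<lambda>i. M2 * e' i)"
      using eq by metis
    then have "\<forall>i<r. M2 * e i = M2 * e' i"
      using s xG by (intro Q.independent_unique[OF _ indQ]) auto
    then have low: "\<forall>i<r. e i = e' i" using M2(1) by simp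
    have "power_product G (\<lambda>i. y i [^] M2) r e = power_product G (\<lambda>i. y i [^] M2) r e'"
      using low by (intro power_product_cong)
    then have "power_product G z q (\<lambda>j. e (r + j)) = power_product G z q (\<lambda>j. e' (r + j))"
      using eq yG zG unfolding split by simp
    then have "power_product (G\<lparr>carrier := N\<rparr>) (\<lambda>i. w (s' i)) q (\<lambda>j. e (r + j)) =
        power_product (G\<lparr>carrier := N\<rparr>) (\<lambda>i. w (s' i)) q (\<lambda>j. e' (r + j))"
      unfolding z_def[symmetric] ppN .
    then have high: "\<forall>j<q. e (r + j) = e' (r + j)"
      using s' wN by (intro Ng.independent_unique[OF _ indN]) auto
    show ?thesis
    proof (intro allI impI)
      fix i assume "i < r + q"
      then show "e i = e' i" using low high[rule_format, of "i - r"] by (cases "i < r") auto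
    qed
  qed

  let ?H = "range (power_product G h (r + q))"
  have ZH: "Z \<subseteq> ?H"
  proof
    fix k assume k: "k \<in> Z"
    then have "k \<in> carrier G" using subgroup.mem_carrier[OF Z] by blast
    then show "k \<in> ?H" using basis.E_mult_in_range[OF k, of "\<lambda>_. 0"] by simp
  qed
  have yH: "y i [^] M2 \<in> ?H" if "i < r" for i
  proof -
    have "power_product G h (r + q) (\<lambda>j. if j = i then 1 else 0) = h i"
      using hG that by (simp add: power_product_unit_vector)
    moreover have "h i = y i [^] M2" using that by (simp add: h_def)
    ultimately show ?thesis by (intro range_eqI[where x = "\<lambda>j. if j = i then 1 else 0"]) simp
  qed
  \<comment> \<open>The subgroup generated by \<open>N\<close> and the elements \<open>y\<close>.\<close>
  define H1 where "H1 = {g \<in> carrier G. \<pi> g \<in> range (power_product Q (\<lambda>i. \<pi> (x (s i))) r)}"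
  have S: "subgroup (range (power_product Q (\<lambda>i. \<pi> (x (s i))) r)) Q"
    using s xG by (intro Q.subgroup_power_products) auto
  have H1: "subgroup H1 G"
    using subgroup.one_closed[OF S] subgroup.m_closed[OF S] subgroup.m_inv_closed[OF S]
    by (intro subgroupI) (auto simp: H1_def)
  have NH1: "N \<subseteq> H1"
    using \<pi>_N N_carrier subgroup.one_closed[OF S] by (auto simp: H1_def)
  have normH1: "H1 \<lhd> G" using H1 comm_N NH1 by (intro normal_if_commutators) auto
  have xH1: "x i [^] M1 \<in> H1" if "i < n" for i
    using M1(2)[OF that] xG[OF that] by (simp add: H1_def \<pi>.hom_int_pow)
  have wH: "w i \<in> carrier G" "w i [^] M2 \<in> ?H" if "i < p" for i
    using wN[OF that] wZ[OF that] ZH N_carrier by blast+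
  have "\<exists>F. finite F \<and> F \<subseteq> carrier G \<and> (\<forall>e. \<exists>f \<in> F. \<exists>k \<in> H1. power_product G x n e = f \<otimes> k)"
    using normH1 xG M1(1) xH1 by (rule finitely_many_remainders)
  then obtain F1 where F1: "finite F1" "F1 \<subseteq> carrier G"
      "\<And>e. \<exists>f \<in> F1. \<exists>k \<in> H1. power_product G x n e = f \<otimes> k"
    by blast
  have "\<exists>F. finite F \<and> F \<subseteq> carrier G \<and> (\<forall>e. \<exists>f \<in> F. \<exists>k \<in> ?H. power_product G y r e = f \<otimes> k)"
    using basis.normal_E yG M2(1) yH by (rule finitely_many_remainders)
  then obtain F2 where F2: "finite F2" "F2 \<subseteq> carrier G"
      "\<And>e. \<exists>f \<in> F2. \<exists>k \<in> ?H. power_product G y r e = f \<otimes> k"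
    by blast
  have "\<exists>F. finite F \<and> F \<subseteq> carrier G \<and> (\<forall>e. \<exists>f \<in> F. \<exists>k \<in> ?H. power_product G w p e = f \<otimes> k)"
    using basis.normal_E wH(1) M2(1) wH(2) by (rule finitely_many_remainders)
  then obtain F3 where F3: "finite F3" "F3 \<subseteq> carrier G"
      "\<And>e. \<exists>f \<in> F3. \<exists>k \<in> ?H. power_product G w p e = f \<otimes> k"
    by blast
  have cover1: "\<exists>f \<in> F1. \<exists>k \<in> H1. g = f \<otimes> k" if g: "g \<in> carrier G" for g
  proof -
    have "\<pi> g \<in> generate Q (\<pi> ` X)"
      using g \<pi>.generate_img[OF X(2)] X(3) by auto
    also have "\<pi> ` X = (\<lambda>i. \<pi> (x i)) ` {..<n}" by (auto simp: x)
    also have "generate Q \<dots> \<subseteq> range (power_product Q (\<lambda>i. \<pi> (x i)) n)"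
      using xG by (intro Q.generate_power_products) auto
    finally obtain e where "\<pi> g = \<pi> (power_product G x n e)"
      using power_product_hom[OF hom, of n x] xG by auto
    then obtain k where k: "k \<in> N" "g = power_product G x n e \<otimes> k"
      using \<pi>_eq g xG by blast
    obtain f k' where f: "f \<in> F1" "k' \<in> H1" "power_product G x n e = f \<otimes> k'" using F1(3) by blast
    have "f \<in> carrier G" "k' \<in> carrier G" "k \<in> carrier G"
      using f k F1(2) N_carrier subgroup.mem_carrier[OF H1] by auto
    then have "g = f \<otimes> (k' \<otimes> k)" using k f by (simp add: m_assoc)
    moreover have "k' \<otimes> k \<in> H1" using subgroup.m_closed[OF H1 f(2)] k NH1 by blast
    ultimately show ?thesis using f(1) by blast
  qed
  let ?F = "(\<lambda>(f, f'). f \<otimes> f') ` (F2 \<times> F3)"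
  have cover2: "\<exists>f \<in> ?F. \<exists>k \<in> ?H. g = f \<otimes> k" if g: "g \<in> H1" for g
  proof -
    obtain e where e: "\<pi> g = \<pi> (power_product G y r e)" "g \<in> carrier G"
      using g \<pi>y unfolding H1_def by auto
    then obtain u where u: "u \<in> N" "g = power_product G y r e \<otimes> u"
      using \<pi>_eq yG by blast
    obtain e' where e': "u = power_product G w p e'" using gen_N[OF u(1)] by blast
    obtain f k where f: "f \<in> F2" "k \<in> ?H" "power_product G y r e = f \<otimes> k" using F2(3) by blast
    obtain f' k' where f': "f' \<in> F3" "k' \<in> ?H" "u = f' \<otimes> k'" using F3(3) e' by blast
    have c: "f \<in> carrier G" "k \<in> carrier G" "f' \<in> carrier G" "k' \<in> carrier G"
      by (rule subsetD[OF F2(2) f(1)] subsetD[OF F3(2) f'(1)]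
          subgroup.mem_carrier[OF basis.subgroup_E f(2)] subgroup.mem_carrier[OF basis.subgroup_E f'(2)])+
    have "f' \<otimes> (inv f' \<otimes> (k \<otimes> (f' \<otimes> k'))) = k \<otimes> (f' \<otimes> k')"
      using c by (simp add: m_assoc[symmetric])
    then have "g = (f \<otimes> f') \<otimes> ((inv f' \<otimes> k \<otimes> f') \<otimes> k')"
      using c by (simp add: u(2) f(3) f'(3) m_assoc)
    moreover have "(inv f' \<otimes> k \<otimes> f') \<otimes> k' \<in> ?H"
      by (rule subgroup.m_closed[OF basis.subgroup_E normal.inv_op_closed1[OF basis.normal_E c(3) f(2)] f'(2)])
    moreover have "f \<otimes> f' \<in> ?F" using f(1) f'(1) by (intro image_eqI[of _ _ "(f, f')"]) auto
    ultimately show ?thesis by blast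
  qed
  have finF: "finite ?F" using F2(1) F3(1) by simp
  have subF: "?F \<subseteq> carrier G" using F2(2) F3(2) by auto
  have "\<exists>F. finite F \<and> F \<subseteq> carrier G \<and> (\<forall>g \<in> carrier G. \<exists>f \<in> F. \<exists>k \<in> ?H. g = f \<otimes> k)"
    using F1(1,2) cover1 finF subF cover2 subgroup.subset[OF basis.subgroup_E]
    by (rule finite_cover_trans)
  then obtain F where F: "finite F" "F \<subseteq> carrier G"
      "\<And>g. g \<in> carrier G \<Longrightarrow> \<exists>f \<in> F. \<exists>k \<in> ?H. g = f \<otimes> k"
    by auto
  show ?thesis using unique F by (rule basis.P_group_of_central_basis)
qed

end

section \<open>Groups of nilpotency class at most two\<close>

theorem corollary5p3:
  fixes G :: "('g, 'm) monoid_scheme"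
  assumes "group G"
    and "finitely_generated_group G"
    and "nilpotent_group G"
    and "nilpotency_class G \<le> 2"
  shows "P_group G"
proof -
  interpret group G by fact
  have trivial: "lower_central G (Suc c) = {\<one>\<^bsub>G\<^esub>}" if "lower_central G c = {\<one>\<^bsub>G\<^esub>}" for c
  proof -
    have "generate G {\<one>\<^bsub>G\<^esub>} = {\<one>\<^bsub>G\<^esub>}" by (rule generate_one)
    moreover have "(\<Union>h \<in> {\<one>\<^bsub>G\<^esub>}. \<Union>k \<in> carrier G. {h \<otimes>\<^bsub>G\<^esub> k \<otimes>\<^bsub>G\<^esub> inv\<^bsub>G\<^esub> h \<otimes>\<^bsub>G\<^esub> inv\<^bsub>G\<^esub> k}) = {\<one>\<^bsub>G\<^esub>}"
      by (auto intro!: bexI[of _ "\<one>\<^bsub>G\<^esub>"])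
    ultimately show ?thesis using that by (simp add: commutator_subgroup_def)
  qed
  have "lower_central G (nilpotency_class G) = {\<one>\<^bsub>G\<^esub>}"
    using assms(3) unfolding nilpotent_group_def nilpotency_class_def by (elim conjE) (rule LeastI_ex)
  \<comment> \<open>The class may be smaller than two, but the lower central series stays trivial once it is.\<close>
  then have "lower_central G (k + nilpotency_class G) = {\<one>\<^bsub>G\<^esub>}" for k
    using trivial by (induction k) (simp_all only: add_0 add_Suc)
  from this[of "2 - nilpotency_class G"] have two: "lower_central G 2 = {\<one>\<^bsub>G\<^esub>}"
    using assms(4) by (simp only: le_add_diff_inverse2)
  obtain X where X: "finite X" "X \<subseteq> carrier G" "generate G X = carrier G"
    using assms(2) unfolding finitely_generated_group_def by blast
  show ?thesis
  proof (rule P_group_of_central_commutators[OF X])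
    fix a b c assume abc: "a \<in> carrier G" "b \<in> carrier G" "c \<in> carrier G"
    have "commutator a b \<in> lower_central G 1"
      using abc by (auto simp: commutator_subgroup_def commutator_def intro!: generate.incl)
    then have "commutator (commutator a b) c \<in> lower_central G 2"
      using abc by (auto simp: numeral_2_eq_2 commutator_subgroup_def commutator_def[of "commutator a b"]
          intro!: generate.incl)
    then have "commutator (commutator a b) c = \<one>\<^bsub>G\<^esub>" using two by simp
    then show "c \<otimes>\<^bsub>G\<^esub> commutator a b = commutator a b \<otimes>\<^bsub>G\<^esub> c"
      using commutator_swap[of "commutator a b" c] abc by simp
  qed
qed

end
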